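(* Let $\varphi$ be a random dynamical system on a non-empty compact metric space $X$ over a memoryless noise space. Then $\varphi$ is stably synchronising if and only if the following three conditions all hold: (i) there is a unique minimal set $K\subset X$ under $\varphi$; (ii) $\varphi$ is two-point contractible on the minimal set $K$; (iii) the minimal set $K$ admits stable trajectories.
   Context: **Setting.** $\mathbb{T}^+$ denotes either $\mathbb{N}\cup\{0\}$ or $[0,\infty)$; $(X,d)$ is a compact metric space with Borel $\sigma$-algebra $\mathcal{B}(X)$. A *memoryless noise space* $(\Omega,\mathcal{F},(\mathcal{F}_t)_{t\in\mathbb{T}^+},\mathbb{P},(\theta^t)_{t\in\mathbb{T}^+})$ consists of a probability space $(\Omega,\mathcal{F},\mathbb{P})$, a filtration $(\mathcal{F}_t)$ of sub-$\sigma$-algebras of $\mathcal{F}$ (with $\mathcal{F}_\infty:=\sigma(\mathcal{F}_t:t\in\mathbb{T}^+)$), and $\mathcal{F}$-measurable maps $\theta^t:\Omega\to\Omega$ such that $\theta^0=\mathrm{id}$, $\theta^{s+t}=\theta^s\circ\theta^t$, each $\theta^t$ is measurable from $(\Omega,\mathcal{F}_{s+t})$ to $(\Omega,\mathcal{F}_s)$ for all $s$, $\mathbb{P}$ is invariant under every $\theta^t$, and for every $s$ the $\sigma$-algebras $\mathcal{F}_s$ and $\theta^{-s}\mathcal{F}_\infty:=\{(\theta^s)^{-1}(E):E\in\mathcal{F}_\infty\}$ are independent under $\mathbb{P}$. A *random dynamical system* (RDS) $\varphi$ on $X$ over it is a family of continuous maps $\varphi(t,\omega):X\to X$ ($t\in\mathbb{T}^+$,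 $\omega\in\Omega$) such that: (a) $(\omega,x)\mapsto\varphi(t,\omega)x$ is $(\mathcal{F}_t\otimes\mathcal{B}(X))$-measurable for each $t$; (b) $\varphi(0,\omega)=\mathrm{id}$; (c) $\varphi(s+t,\omega)=\varphi(t,\theta^s\omega)\circ\varphi(s,\omega)$ for all $s,t,\omega$; (d) if $t_n$ decreases to $t$ in $\mathbb{T}^+$ and $x_n\to x$ in $X$, then $\varphi(t_n,\omega)x_n\to\varphi(t,\omega)x$ for all $\omega$; (e) there is a function $\varphi_-:\mathbb{T}^+\times\Omega\times X\to X$ such that if $t_n$ is strictly increasing in $\mathbb{T}^+$ with limit $t\in\mathbb{T}^+$ and $x_n\to x$, then $\varphi(t_n,\omega)x_n\to\varphi_-(t,\omega,x)$ for all $\omega$. **Minimal sets.** A closed set $K\subset X$ is *forward-invariant* if $\mathbb{P}(\omega:\forall t\in\mathbb{T}^+,\ \varphi(t,\omega)K\subset K)=1$. A set $K\subset X$ is *minimal* if it is non-empty, closed and forward-invariant, and its only closed forward-invariant subsets are $K$ and $\emptyset$. **Synchronisation and stability.** A non-empty set $A\subset X$ *contracts under* $\omega$ if $\mathrm{diam}(\varphi(t,\omega)A)\to0$ as $t\to\infty$. Points $x,y$ *mutually converge under* $\omega$ if $\{x,y\}$ contracts under $\omega$. $\varphi$ is *synchronising* if for all $x,y\in X$, $\mathbb{P}(\omega: x\text{ and }y\text{ mutually converge under }\omega)=1$. A pair $(\omega,x)\in\Omega\times X$ is *asymptotically stable* if some neighbourhood of $x$ contracts under $\omega$. A point $x\in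 X$ is *almost surely stable* if $\mathbb{P}(\omega:(\omega,x)\text{ is asymptotically stable})=1$. $\varphi$ is *stably synchronising* if it is synchronising and every point of $X$ is almost surely stable. A closed forward-invariant set $K$ *admits stable trajectories* if $\mathbb{P}(\omega:\exists x\in K\text{ such that }(\omega,x)\text{ is asymptotically stable})>0$. **Two-point contractibility.** For a closed forward-invariant $K\subset X$, $\varphi$ is *two-point contractible on $K$* if for all $x,y\in K$ and all $\varepsilon>0$, $\mathbb{P}(\omega:\exists t\in\mathbb{T}^+\text{ such that }d(\varphi(t,\omega)x,\varphi(t,\omega)y)<\varepsilon)>0$. *)

theory Defs
  imports "HOL-Probability.Probability"
begin

text \<open>
  Time is a set \<open>T\<close> of reals, either \<open>\<nat>\<close> (which contains \<open>0\<close>) or \<open>{0..}\<close>, so that discrete and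
  continuous time are treated together; objects indexed by time are only constrained at times in
  \<open>T\<close>. The sample space is \<open>space M\<close>, and of each measure \<open>F t\<close> only \<open>space\<close> and \<open>sets\<close> are relevant.
\<close>

locale memoryless_noise_space = prob_space M
  for T :: "real set" and M :: "'w measure" +
  fixes F :: "real \<Rightarrow> 'w measure" and \<theta> :: "real \<Rightarrow> 'w \<Rightarrow> 'w"
  assumes time: "T = \<nat> \<or> T = {0..}"
    and subalgebra_F: "t \<in> T \<Longrightarrow> subalgebra M (F t)"
    and sets_F_mono: "\<lbrakk>s \<in> T; t \<in> T; s \<le> t\<rbrakk> \<Longrightarrow> sets (F s) \<subseteq> sets (F t)"
    and shift_measurable: "t \<in> T \<Longrightarrow> \<theta> t \<in> measurable M M"
    and shift_0: "\<omega> \<in> space M \<Longrightarrow> \<theta> 0 \<omega> = \<omega>"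
    and shift_add: "\<lbrakk>s \<in> T; t \<in> T; \<omega> \<in> space M\<rbrakk> \<Longrightarrow> \<theta> (s + t) \<omega> = \<theta> s (\<theta> t \<omega>)"
    and shift_adapted: "\<lbrakk>s \<in> T; t \<in> T\<rbrakk> \<Longrightarrow> \<theta> t \<in> measurable (F (s + t)) (F s)"
    and shift_invariant: "t \<in> T \<Longrightarrow> distr M M (\<theta> t) = M"
    and memoryless: "s \<in> T \<Longrightarrow>
      indep_set (sets (F s))
        {\<theta> s -` E \<inter> space M | E. E \<in> sigma_sets (space M) (\<Union>t\<in>T. sets (F t))}"

locale random_dynamical_system = memoryless_noise_space T M F \<theta>
  for T :: "real set" and M :: "'w measure" and F and \<theta> +
  fixes \<phi> :: "real \<Rightarrow> 'w \<Rightarrow> 'x::metric_space \<Rightarrow> 'x"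
  assumes continuous: "\<lbrakk>t \<in> T; \<omega> \<in> space M\<rbrakk> \<Longrightarrow> continuous_on UNIV (\<phi> t \<omega>)"
    and adapted: "t \<in> T \<Longrightarrow> (\<lambda>(\<omega>, x). \<phi> t \<omega> x) \<in> measurable (F t \<Otimes>\<^sub>M borel) borel"
    and zero: "\<omega> \<in> space M \<Longrightarrow> \<phi> 0 \<omega> = id"
    and cocycle: "\<lbrakk>s \<in> T; t \<in> T; \<omega> \<in> space M\<rbrakk> \<Longrightarrow> \<phi> (s + t) \<omega> = \<phi> t (\<theta> s \<omega>) \<circ> \<phi> s \<omega>"
    and right_continuous:
      "\<And>t \<omega> x ts xs. \<lbrakk>t \<in> T; \<omega> \<in> space M; range ts \<subseteq> T; decseq ts; ts \<longlonglongrightarrow> t; xs \<longlonglongrightarrow> x\<rbrakk>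
        \<Longrightarrow> (\<lambda>n. \<phi> (ts n) \<omega> (xs n)) \<longlonglongrightarrow> \<phi> t \<omega> x"
    and left_limits:
      "\<exists>\<phi>m :: real \<Rightarrow> 'w \<Rightarrow> 'x \<Rightarrow> 'x. \<forall>t\<in>T. \<forall>\<omega>\<in>space M. \<forall>x ts xs.
        range ts \<subseteq> T \<and> strict_mono ts \<and> ts \<longlonglongrightarrow> t \<and> xs \<longlonglongrightarrow> x
        \<longrightarrow> (\<lambda>n. \<phi> (ts n) \<omega> (xs n)) \<longlonglongrightarrow> \<phi>m t \<omega> x"

text \<open>
  Below, \<open>forward_invariant\<close>, \<open>admits_stable_trajectories\<close> and \<open>two_point_contractible\<close> are meant for
  closed sets, and \<open>contracts\<close> for non-empty sets. For a random dynamical system on a compact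
  space all events involved are measurable: since \<open>\<phi>\<close> is continuous in space and right-continuous in
  time, the quantifiers over times and points reduce to countable ones.
\<close>

definition forward_invariant ::
  "real set \<Rightarrow> 'w measure \<Rightarrow> (real \<Rightarrow> 'w \<Rightarrow> 'x::metric_space \<Rightarrow> 'x) \<Rightarrow> 'x set \<Rightarrow> bool" where
  "forward_invariant T M \<phi> K \<longleftrightarrow> \<P>(\<omega> in M. \<forall>t\<in>T. \<phi> t \<omega> ` K \<subseteq> K) = 1"

definition minimal_set ::
  "real set \<Rightarrow> 'w measure \<Rightarrow> (real \<Rightarrow> 'w \<Rightarrow> 'x::metric_space \<Rightarrow> 'x) \<Rightarrow> 'x set \<Rightarrow> bool" where
  "minimal_set T M \<phi> K \<longleftrightarrow>
    K \<noteq> {} \<and> closed K \<and> forward_invariant T M \<phi> K \<and>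
    (\<forall>L. L \<subseteq> K \<and> closed L \<and> forward_invariant T M \<phi> L \<longrightarrow> L = K \<or> L = {})"

definition contracts ::
  "real set \<Rightarrow> (real \<Rightarrow> 'w \<Rightarrow> 'x::metric_space \<Rightarrow> 'x) \<Rightarrow> 'w \<Rightarrow> 'x set \<Rightarrow> bool" where
  "contracts T \<phi> \<omega> A \<longleftrightarrow>
    ((\<lambda>t. diameter (\<phi> t \<omega> ` A)) \<longlongrightarrow> 0) (inf at_top (principal T))"

definition mutually_converge ::
  "real set \<Rightarrow> (real \<Rightarrow> 'w \<Rightarrow> 'x::metric_space \<Rightarrow> 'x) \<Rightarrow> 'w \<Rightarrow> 'x \<Rightarrow> 'x \<Rightarrow> bool" where
  "mutually_converge T \<phi> \<omega> x y \<longleftrightarrow> contracts T \<phi> \<omega> {x, y}"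

definition synchronising ::
  "real set \<Rightarrow> 'w measure \<Rightarrow> (real \<Rightarrow> 'w \<Rightarrow> 'x::metric_space \<Rightarrow> 'x) \<Rightarrow> bool" where
  "synchronising T M \<phi> \<longleftrightarrow> (\<forall>x y. \<P>(\<omega> in M. mutually_converge T \<phi> \<omega> x y) = 1)"

definition asymptotically_stable ::
  "real set \<Rightarrow> (real \<Rightarrow> 'w \<Rightarrow> 'x::metric_space \<Rightarrow> 'x) \<Rightarrow> 'w \<Rightarrow> 'x \<Rightarrow> bool" where
  "asymptotically_stable T \<phi> \<omega> x \<longleftrightarrow> (\<exists>A. x \<in> interior A \<and> contracts T \<phi> \<omega> A)"

definition almost_surely_stable ::
  "real set \<Rightarrow> 'w measure \<Rightarrow> (real \<Rightarrow> 'w \<Rightarrow> 'x::metric_space \<Rightarrow> 'x) \<Rightarrow> 'x \<Rightarrow> bool" where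
  "almost_surely_stable T M \<phi> x \<longleftrightarrow> \<P>(\<omega> in M. asymptotically_stable T \<phi> \<omega> x) = 1"

definition stably_synchronising ::
  "real set \<Rightarrow> 'w measure \<Rightarrow> (real \<Rightarrow> 'w \<Rightarrow> 'x::metric_space \<Rightarrow> 'x) \<Rightarrow> bool" where
  "stably_synchronising T M \<phi> \<longleftrightarrow> synchronising T M \<phi> \<and> (\<forall>x. almost_surely_stable T M \<phi> x)"

definition admits_stable_trajectories ::
  "real set \<Rightarrow> 'w measure \<Rightarrow> (real \<Rightarrow> 'w \<Rightarrow> 'x::metric_space \<Rightarrow> 'x) \<Rightarrow> 'x set \<Rightarrow> bool" where
  "admits_stable_trajectories T M \<phi> K \<longleftrightarrow>
    \<P>(\<omega> in M. \<exists>x\<in>K. asymptotically_stable T \<phi> \<omega> x) > 0"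

definition two_point_contractible ::
  "real set \<Rightarrow> 'w measure \<Rightarrow> (real \<Rightarrow> 'w \<Rightarrow> 'x::metric_space \<Rightarrow> 'x) \<Rightarrow> 'x set \<Rightarrow> bool" where
  "two_point_contractible T M \<phi> K \<longleftrightarrow>
    (\<forall>x\<in>K. \<forall>y\<in>K. \<forall>\<epsilon>>0. \<P>(\<omega> in M. \<exists>t\<in>T. dist (\<phi> t \<omega> x) (\<phi> t \<omega> y) < \<epsilon>) > 0)"

end

theory Submission
  imports Defs
begin

text \<open>
  Suppose the three conditions hold. By (iii) some open set \<open>U\<close> meeting \<open>K\<close> contracts with positive
  probability. The points from which \<open>U\<close> is almost surely never reached form a closed
  forward-invariant set; by uniqueness of \<open>K\<close> it is empty, so \<open>U\<close> is reached from everywhere with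
  positive probability, uniformly by compactness. An approximation argument in the spirit of
  Levy's zero-one law upgrades this: almost surely the trajectory is at some time in \<open>U\<close> while the
  future noise contracts \<open>U\<close>. This gives almost sure stability of every point.

  Synchronisation follows from the same argument for the two-point motion on \<open>X \<times> X\<close> and the
  open set \<open>U \<times> U\<close>: a minimal set of the two-point motion lies in \<open>K \<times> K\<close> by uniqueness of \<open>K\<close>,
  meets the diagonal by (ii), and therefore meets \<open>U \<times> U\<close>.
\<close>

text \<open>Independence is given only at deterministic times, between \<open>F s\<close> and the
  preimages under \<open>\<theta> s\<close> of sets in \<open>F_infty\<close>, so the argument does
  not wait for the first visit to \<open>U\<close>. Attempts are made at fixed rational times
  instead: the success probability is uniform in the starting point, while the time of the attempt
  may depend on it. That the points never reaching \<open>U\<close> form a closed set comes from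
  Fatou's lemma: the probability of being in an open set at a fixed time is lower semicontinuous in
  the starting point. Meeting the diagonal helps because a pair \<open>(z, z)\<close> moves as a
  single point and enters \<open>U \<times> U\<close> whenever \<open>z\<close> enters
  \<open>U\<close>. Decoupling past and future noise, and approximating events from the filtration,
  work for events of \<open>F_infty\<close>; this is why quantifiers over times and points are
  always cut down to rational times and countable dense sets. The converse is soft: under
  synchronisation two disjoint minimal sets, being compact and hence at positive distance, cannot
  coexist, and the events in (ii) and (iii) even have probability one.\<close>

section \<open>Countable bases and measurability in compact metric spaces\<close>

text \<open>The base consists of balls around finite nets at the scales
  \<open>inverse (real (Suc m))\<close>. It is enumerated by the naturals so that a recursion can
  run through it when a minimal set is constructed.\<close>

lemma compact_countable_base:
  assumes "compact (UNIV :: 'x::metric_space set)"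
  obtains B :: "nat \<Rightarrow> 'x::metric_space set"
  where "\<And>n. open (B n)" "\<And>S x. open S \<Longrightarrow> x \<in> S \<Longrightarrow> \<exists>n. x \<in> B n \<and> B n \<subseteq> S"
proof -
  have "\<forall>e>0. \<exists>k::'x set. finite k \<and> (UNIV::'x set) \<subseteq> (\<Union>x\<in>k. ball x e)"
    using seq_compact_imp_totally_bounded[of "UNIV::'x set"] assms
    by (metis compact_imp_seq_compact)
  then have "\<forall>m. \<exists>k::'x set. finite k \<and> (UNIV::'x set) \<subseteq> (\<Union>x\<in>k. ball x (inverse (real (Suc m))))"
    by simp
  then obtain k :: "nat \<Rightarrow> 'x set" where k': "\<forall>m. finite (k m) \<and>
      UNIV \<subseteq> (\<Union>x\<in>k m. ball x (inverse (real (Suc m))))"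
    by (rule choice[THEN exE])
  have k: "finite (k m)" "UNIV \<subseteq> (\<Union>x\<in>k m. ball x (inverse (real (Suc m))))" for m
    using k' by blast+
  define BB where "BB = (\<Union>m. (\<lambda>x. ball x (inverse (real (Suc m)))) ` k m)"
  have cnt: "countable BB"
    unfolding BB_def by (rule countable_UN[OF countableI_type countable_image[OF countable_finite[OF k(1)]]])
  have ne: "BB \<noteq> {}"
  proof -
    have "k 0 \<noteq> {}" using k(2)[of 0] by auto
    then show ?thesis unfolding BB_def by blast
  qed
  have base: "\<exists>b\<in>BB. x \<in> b \<and> b \<subseteq> S" if S: "open S" "x \<in> S" for S x
  proof -
    obtain e where e: "e > 0" "ball x e \<subseteq> S"
      using S open_contains_ball by blast
    obtain m where m: "inverse (real (Suc m)) < e / 2"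
      using reals_Archimedean[of "e/2"] e(1) by auto
    obtain y where y: "y \<in> k m" "x \<in> ball y (inverse (real (Suc m)))"
      using k(2)[of m] by blast
    have "ball y (inverse (real (Suc m))) \<subseteq> ball x e"
    proof
      fix z assume "z \<in> ball y (inverse (real (Suc m)))"
      then have "dist y z < e/2" "dist y x < e/2" using y(2) m by auto
      then show "z \<in> ball x e"
        using dist_triangle2[of x z y] by (simp add: dist_commute)
    qed
    then show ?thesis using y e(2) unfolding BB_def by blast
  qed
  have "open (from_nat_into BB n)" for n
    using from_nat_into[OF ne, of n] unfolding BB_def by auto
  moreover have "\<exists>n. x \<in> from_nat_into BB n \<and> from_nat_into BB n \<subseteq> S" if "open S" "x \<in> S" for S x
    using base[OF that] from_nat_into_surj[OF cnt] by metis
  ultimately show ?thesis by (rule that)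
qed

text \<open>Obtained by choosing a point of \<open>A\<close> in every base set that meets
  \<open>A\<close>. The dense set lies inside \<open>A\<close> because invariance and contraction
  are statements about the points of a given set.\<close>

lemma compact_countable_dense_subset:
  fixes A :: "'x::metric_space set"
  assumes "compact (UNIV :: 'x set)"
  obtains D where "countable D" "D \<subseteq> A" "A \<subseteq> closure D"
proof -
  obtain B :: "nat \<Rightarrow> 'x set" where B: "\<And>n. open (B n)"
      "\<And>S x. open S \<Longrightarrow> x \<in> S \<Longrightarrow> \<exists>n. x \<in> B n \<and> B n \<subseteq> S"
    using compact_countable_base[OF assms] by blast
  define D where "D = (\<lambda>n. SOME a. a \<in> B n \<inter> A) ` {n. B n \<inter> A \<noteq> {}}"
  have D: "(SOME a. a \<in> B n \<inter> A) \<in> B n \<inter> A" if "B n \<inter> A \<noteq> {}" for n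
    using that by (meson ex_in_conv someI_ex)
  have "A \<subseteq> closure D"
  proof
    fix x assume x: "x \<in> A"
    show "x \<in> closure D"
      unfolding closure_iff_nhds_not_empty
    proof (intro allI impI)
      fix S V :: "'x set" assume "V \<subseteq> S" "open V" "x \<in> V"
      then obtain n where n: "x \<in> B n" "B n \<subseteq> V" using B(2) by blast
      then have "B n \<inter> A \<noteq> {}" using x by blast
      from D[OF this] this show "D \<inter> S \<noteq> {}"
        unfolding D_def using n \<open>V \<subseteq> S\<close> by blast
    qed
  qed
  moreover have "D \<subseteq> A" using D unfolding D_def by blast
  moreover have "countable D" unfolding D_def by auto
  ultimately show ?thesis using that[of D] by simp
qed

text \<open>The type class provides no second countability, so \<open>borel_prod\<close> and
  \<open>borel_measurable_dist\<close> are not available.\<close>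

lemma borel_measurable_Pair_compact:
  fixes f g :: "'a \<Rightarrow> 'x::metric_space"
  assumes "compact (UNIV :: 'x set)"
    and f: "f \<in> measurable N borel" and g: "g \<in> measurable N borel"
  shows "(\<lambda>a. (f a, g a)) \<in> measurable N (borel :: ('x \<times> 'x) measure)"
proof (rule borel_measurableI)
  fix S :: "('x \<times> 'x) set" assume S: "open S"
  obtain B :: "nat \<Rightarrow> 'x set" where B: "\<And>n. open (B n)"
      "\<And>S x. open S \<Longrightarrow> x \<in> S \<Longrightarrow> \<exists>n. x \<in> B n \<and> B n \<subseteq> S"
    using compact_countable_base[OF assms(1)] by blast
  have "(\<lambda>a. (f a, g a)) -` S \<inter> space N =
      (\<Union>(m, n)\<in>{(m, n). B m \<times> B n \<subseteq> S}. (f -` B m \<inter> space N) \<inter> (g -` B n \<inter> space N))"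
    (is "?L = ?R")
  proof
    show "?L \<subseteq> ?R"
    proof
      fix a assume a: "a \<in> ?L"
      then obtain U V where "open U" "open V" "(f a, g a) \<in> U \<times> V" "U \<times> V \<subseteq> S"
        using open_prod_elim[OF S, of "(f a, g a)"] by auto
      then obtain m n where "f a \<in> B m" "B m \<subseteq> U" "g a \<in> B n" "B n \<subseteq> V"
        using B(2) by (meson SigmaD1 SigmaD2)
      moreover have "B m \<times> B n \<subseteq> S" using calculation \<open>U \<times> V \<subseteq> S\<close> by blast
      ultimately show "a \<in> ?R" using a by blast
    qed
  qed auto
  also have "\<dots> \<in> sets N"
    using f g B(1)
    by (intro sets.countable_UN' countableI_type) (auto intro!: sets.Int measurable_sets)
  finally show "(\<lambda>a. (f a, g a)) -` S \<inter> space N \<in> sets N" .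
qed

lemma borel_measurable_dist_compact:
  fixes f g :: "'a \<Rightarrow> 'x::metric_space"
  assumes "compact (UNIV :: 'x set)"
    and "f \<in> measurable N borel" and "g \<in> measurable N borel"
  shows "(\<lambda>a. dist (f a) (g a)) \<in> borel_measurable N"
proof -
  have "(\<lambda>p::'x \<times> 'x. dist (fst p) (snd p)) \<in> borel_measurable borel"
    by (intro borel_measurable_continuous_onI continuous_intros)
  from measurable_compose[OF borel_measurable_Pair_compact[OF assms] this]
  show ?thesis by simp
qed

text \<open>Positivity already makes the event measurable, since a non-measurable set has measure 0;
  hence it is not null and meets the almost sure event.\<close>

lemma (in prob_space) exists_if_prob_pos:
  assumes "\<P>(x in M. P x) > 0" "AE x in M. Q x"
  obtains x where "x \<in> space M" "P x" "Q x"
proof -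
  have "{x \<in> space M. P x} \<in> sets M"
    using assms(1) measure_notin_sets by fastforce
  then have "\<not> (AE x in M. \<not> P x)"
    using prob_Collect_eq_0 assms(1) by fastforce
  moreover have "AE x in M. \<not> P x" if none: "\<not> (\<exists>x\<in>space M. P x \<and> Q x)"
    using assms(2) AE_space by eventually_elim (use none in blast)
  ultimately show ?thesis using that by blast
qed

lemma minimal_setD:
  assumes "minimal_set T M \<phi> K"
  shows "K \<noteq> {}" "closed K" "forward_invariant T M \<phi> K"
    "\<And>L. L \<subseteq> K \<Longrightarrow> closed L \<Longrightarrow> forward_invariant T M \<phi> L \<Longrightarrow> L \<noteq> {} \<Longrightarrow> L = K"
  using assms unfolding minimal_set_def by auto

subsection \<open>Memoryless noise\<close>

context memoryless_noise_space
begin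

text \<open>In discrete time this is \<open>T\<close> itself. In continuous time it is countable,
  approximates every time from the right, and is closed under addition, so cocycle arguments never
  leave it.\<close>

definition rational_times :: "real set" where
  "rational_times = T \<inter> \<rat>"

definition F_infty :: "'w measure" where
  "F_infty = sigma (space M) (\<Union>t\<in>T. sets (F t))"

lemma T_cases:
  obtains (discrete) "T = \<nat>" | (continuous) "T = {0..}"
  using time by blast

lemma T_add: "s \<in> T \<Longrightarrow> t \<in> T \<Longrightarrow> s + t \<in> T"
  by (cases rule: T_cases) simp_all

lemma T_diff: "s \<in> T \<Longrightarrow> t \<in> T \<Longrightarrow> s \<le> t \<Longrightarrow> t - s \<in> T"
  by (cases rule: T_cases) simp_all

lemma T_of_nat: "real n \<in> T"
  by (cases rule: T_cases) simp_all

lemma rational_timesD: "t \<in> rational_times \<Longrightarrow> t \<in> T"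
  by (simp add: rational_times_def)

lemma rational_times_add:
  "s \<in> rational_times \<Longrightarrow> t \<in> rational_times \<Longrightarrow> s + t \<in> rational_times"
  by (simp add: rational_times_def T_add)

lemma of_nat_rational_times: "real n \<in> rational_times"
  by (simp add: rational_times_def T_of_nat)

lemma zero_rational_times: "0 \<in> rational_times"
  using of_nat_rational_times[of 0] by simp

lemma countable_rational_times: "countable rational_times"
  unfolding rational_times_def using countable_rat by blast

lemma rational_times_right_dense:
  assumes "t \<in> T"
  obtains ts where "range ts \<subseteq> rational_times" "decseq ts" "ts \<longlonglongrightarrow> t" "\<And>n. t \<le> ts n"
proof (cases "T = \<nat>")
  case True
  then have "t \<in> rational_times"
    using assms unfolding rational_times_def by (auto elim!: Nats_cases)
  then show ?thesis using that[of "\<lambda>_. t"] by (auto simp: decseq_def)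
next
  case False
  then have T: "T = {0..}" using time by blast
  \<comment> \<open>Rounding up to the dyadic grid: these grids are nested, so the approximations
    decrease in \<open>n\<close>, as \<open>right_continuous\<close> demands.\<close>
  define ts where "ts n = of_int \<lceil>t * 2 ^ n\<rceil> / (2 ^ n :: real)" for n :: nat
  have lower: "t \<le> ts n" for n
    unfolding ts_def by (simp add: field_simps)
  have upper: "ts n \<le> t + (1/2) ^ n" for n
  proof -
    have "of_int \<lceil>t * 2 ^ n\<rceil> \<le> t * 2 ^ n + 1" by linarith
    then show ?thesis unfolding ts_def by (simp add: field_simps)
  qed
  have "decseq ts"
  proof (rule decseq_SucI)
    fix n
    have "\<lceil>t * 2 ^ Suc n\<rceil> \<le> 2 * \<lceil>t * 2 ^ n\<rceil>"
      by (simp add: ceiling_le_iff)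
    then have "real_of_int \<lceil>t * 2 ^ Suc n\<rceil> \<le> 2 * real_of_int \<lceil>t * 2 ^ n\<rceil>"
      by linarith
    then show "ts (Suc n) \<le> ts n" unfolding ts_def by (simp add: field_simps)
  qed
  moreover have "ts \<longlonglongrightarrow> t"
  proof (rule tendsto_sandwich[of "\<lambda>_. t" ts _ "\<lambda>n. t + (1/2) ^ n"])
    show "(\<lambda>n. t + (1/2) ^ n) \<longlonglongrightarrow> t"
      using tendsto_add[OF tendsto_const[of t] LIMSEQ_power_zero[of "1/2::real"]] by simp
  qed (use lower upper in auto)
  moreover have "range ts \<subseteq> rational_times"
    using assms lower T unfolding rational_times_def
    by (auto intro: order_trans) (auto simp: ts_def)
  ultimately show ?thesis using that lower by blast
qed

section \<open>The limit sigma-algebra, decoupling of past and future, approximation\<close>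

lemma space_F: "t \<in> T \<Longrightarrow> space (F t) = space M"
  using subalgebra_F by (simp add: subalgebra_def)

lemma Union_F_Pow: "(\<Union>t\<in>T. sets (F t)) \<subseteq> Pow (space M)"
  using sets.sets_into_space space_F by fastforce

lemma space_F_infty [simp]: "space F_infty = space M"
  by (simp add: F_infty_def Union_F_Pow)

lemma sets_F_infty: "sets F_infty = sigma_sets (space M) (\<Union>t\<in>T. sets (F t))"
  unfolding F_infty_def using Union_F_Pow by (rule sets_measure_of)

lemma subalgebra_F_infty: "subalgebra M F_infty"
  unfolding subalgebra_def sets_F_infty
proof (intro conjI space_F_infty sets.sigma_sets_subset)
  show "(\<Union>t\<in>T. sets (F t)) \<subseteq> sets M"
    using subalgebra_F by (auto simp: subalgebra_def)
qed

lemma subalgebra_F_infty_F: "t \<in> T \<Longrightarrow> subalgebra F_infty (F t)"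
  by (auto simp: subalgebra_def sets_F_infty space_F intro: sigma_sets.Basic)

lemma sets_F_infty_M: "A \<in> sets F_infty \<Longrightarrow> A \<in> sets M"
  using subalgebra_F_infty by (auto simp: subalgebra_def)

lemma shift_measurable_infty:
  assumes "t \<in> T"
  shows "\<theta> t \<in> measurable F_infty F_infty"
proof -
  have "\<theta> t \<in> space M \<rightarrow> space M"
    using shift_measurable[OF assms] by (auto simp: measurable_def)
  moreover have "\<theta> t -` E \<inter> space F_infty \<in> sets F_infty" if E: "E \<in> (\<Union>s\<in>T. sets (F s))" for E
  proof -
    obtain s where s: "s \<in> T" "E \<in> sets (F s)" using E by blast
    have "\<theta> t -` E \<inter> space (F (s + t)) \<in> sets (F (s + t))"
      using shift_adapted[OF s(1) assms] s(2) by (rule measurable_sets)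
    then show ?thesis
      using subalgebra_F_infty_F[of "s + t"] s(1) assms space_F[of "s + t"]
      by (auto simp: subalgebra_def T_add)
  qed
  ultimately show ?thesis
    using Union_F_Pow measurable_measure_of[of "\<Union>t\<in>T. sets (F t)" "space M" "\<theta> t" F_infty]
    by (simp add: F_infty_def)
qed

lemma shift_measurable_M_infty: "t \<in> T \<Longrightarrow> \<theta> t \<in> measurable M F_infty"
  using shift_measurable_infty measurable_from_subalg subalgebra_F_infty by blast

lemma emeasure_shift:
  assumes "t \<in> T" "A \<in> sets F_infty"
  shows "emeasure M (\<theta> t -` A \<inter> space M) = emeasure M A"
  using emeasure_distr[OF shift_measurable[OF assms(1)] sets_F_infty_M[OF assms(2)]]
    shift_invariant[OF assms(1)] by simp

text \<open>The basis of all Markov arguments here. The past up to \<open>s\<close> and the shifted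
  noise are independent, so the pair \<open>(\<omega>, \<theta> s \<omega>)\<close> has a product
  law; by invariance of the measure the second factor may be replaced by a fresh copy
  \<open>\<omega>'\<close>, and Fubini gives the formula.\<close>

lemma emeasure_decouple:
  assumes s: "s \<in> T" and H: "H \<in> sets (F s \<Otimes>\<^sub>M F_infty)"
  shows "emeasure M {\<omega> \<in> space M. (\<omega>, \<theta> s \<omega>) \<in> H} =
    (\<integral>\<^sup>+ \<omega>. emeasure M {\<omega>' \<in> space M. (\<omega>, \<omega>') \<in> H} \<partial>M)"
proof -
  have id: "(\<lambda>\<omega>. \<omega>) \<in> measurable M (F s)"
    using subalgebra_F[OF s] by (auto simp: subalgebra_def measurable_def)
  note sh = shift_measurable_M_infty[OF s]
  have eq1: "{(\<lambda>\<omega>. \<omega>) -` A \<inter> space M |A. A \<in> sets (F s)} = sets (F s)"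
    using sets.sets_into_space[of _ "F s"] space_F[OF s] by (auto simp: Int_absorb2)
  have "indep_set (sigma_sets (space M) {(\<lambda>\<omega>. \<omega>) -` A \<inter> space M |A. A \<in> sets (F s)})
      (sigma_sets (space M) {\<theta> s -` A \<inter> space M |A. A \<in> sets F_infty})"
  proof (rule indep_set_sigma_sets)
    show "indep_set {(\<lambda>\<omega>. \<omega>) -` A \<inter> space M |A. A \<in> sets (F s)}
        {\<theta> s -` A \<inter> space M |A. A \<in> sets F_infty}"
      using memoryless[OF s] unfolding eq1 sets_F_infty by simp
    show "Int_stable {(\<lambda>\<omega>. \<omega>) -` A \<inter> space M |A. A \<in> sets (F s)}"
      unfolding eq1 by (rule sets.Int_stable)
    show "Int_stable {\<theta> s -` A \<inter> space M |A. A \<in> sets F_infty}"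
    proof (rule Int_stableI, clarify)
      fix A A' assume "A \<in> sets F_infty" "A' \<in> sets F_infty"
      then show "\<exists>E. \<theta> s -` A \<inter> space M \<inter> (\<theta> s -` A' \<inter> space M) = \<theta> s -` E \<inter> space M \<and>
          E \<in> sets F_infty"
        by (intro exI[of _ "A \<inter> A'"]) auto
    qed
  qed
  then have "indep_var (F s) (\<lambda>\<omega>. \<omega>) F_infty (\<theta> s)"
    unfolding indep_var_eq using id sh by auto
  then have joint: "distr M (F s) (\<lambda>\<omega>. \<omega>) \<Otimes>\<^sub>M distr M F_infty (\<theta> s) =
      distr M (F s \<Otimes>\<^sub>M F_infty) (\<lambda>\<omega>. (\<omega>, \<theta> s \<omega>))"
    unfolding indep_var_distribution_eq by blast
  interpret D: prob_space "distr M F_infty (\<theta> s)"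
    using sh by (rule prob_space_distr)
  have pair: "(\<lambda>\<omega>. (\<omega>, \<theta> s \<omega>)) \<in> measurable M (F s \<Otimes>\<^sub>M F_infty)"
    using id sh by measurable
  have "emeasure M {\<omega> \<in> space M. (\<omega>, \<theta> s \<omega>) \<in> H} =
      emeasure (distr M (F s \<Otimes>\<^sub>M F_infty) (\<lambda>\<omega>. (\<omega>, \<theta> s \<omega>))) H"
    unfolding emeasure_distr[OF pair H]
    by (rule arg_cong[where f = "emeasure M"]) auto
  also have "\<dots> = (\<integral>\<^sup>+ \<omega>. emeasure (distr M F_infty (\<theta> s)) (Pair \<omega> -` H)
      \<partial>distr M (F s) (\<lambda>\<omega>. \<omega>))"
    unfolding joint[symmetric]
    by (rule D.emeasure_pair_measure_alt) (use H in simp)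
  also have "\<dots> = (\<integral>\<^sup>+ \<omega>. emeasure (distr M F_infty (\<theta> s)) (Pair \<omega> -` H) \<partial>M)"
    using H by (intro nn_integral_distr[OF id] D.measurable_emeasure_Pair) simp
  also have "\<dots> = (\<integral>\<^sup>+ \<omega>. emeasure M {\<omega>' \<in> space M. (\<omega>, \<omega>') \<in> H} \<partial>M)"
  proof (rule nn_integral_cong)
    fix \<omega>
    have sec: "Pair \<omega> -` H \<in> sets F_infty" using H by (rule sets_Pair1)
    have "Pair \<omega> -` H = {\<omega>' \<in> space M. (\<omega>, \<omega>') \<in> H}"
      using sets.sets_into_space[OF sec] by auto
    then show "emeasure (distr M F_infty (\<theta> s)) (Pair \<omega> -` H) =
        emeasure M {\<omega>' \<in> space M. (\<omega>, \<omega>') \<in> H}"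
      using emeasure_distr[OF sh sec] emeasure_shift[OF s sec] by simp
  qed
  finally show ?thesis .
qed

lemma AE_decouple:
  assumes s: "s \<in> T" and H: "H \<in> sets (F s \<Otimes>\<^sub>M F_infty)"
    and AE: "AE \<omega> in M. (\<omega>, \<theta> s \<omega>) \<notin> H"
  shows "AE \<omega> in M. AE \<omega>' in M. (\<omega>, \<omega>') \<notin> H"
proof -
  have id: "(\<lambda>\<omega>. \<omega>) \<in> measurable M F_infty" "(\<lambda>\<omega>. \<omega>) \<in> measurable M (F s)"
    using subalgebra_F_infty subalgebra_F[OF s] by (auto simp: subalgebra_def measurable_def)
  \<comment> \<open>This is \<open>M\<close> restricted to \<open>F_infty\<close>: measurability of
    the section probabilities refers to a measure carrying exactly the second sigma-algebra of the
    product.\<close>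
  interpret D: prob_space "distr M F_infty (\<lambda>\<omega>. \<omega>)"
    using id(1) by (rule prob_space_distr)
  have sec: "{\<omega>' \<in> space M. (\<omega>, \<omega>') \<in> H} \<in> sets F_infty" for \<omega>
  proof -
    have "Pair \<omega> -` H \<in> sets F_infty" using H by (rule sets_Pair1)
    moreover from sets.sets_into_space[OF this]
    have "Pair \<omega> -` H = {\<omega>' \<in> space M. (\<omega>, \<omega>') \<in> H}" by auto
    ultimately show ?thesis by simp
  qed
  have "(\<lambda>\<omega>. emeasure (distr M F_infty (\<lambda>\<omega>. \<omega>)) (Pair \<omega> -` H)) \<in> borel_measurable (F s)"
    using H by (intro D.measurable_emeasure_Pair) simp
  moreover have "emeasure (distr M F_infty (\<lambda>\<omega>. \<omega>)) (Pair \<omega> -` H) =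
      emeasure M {\<omega>' \<in> space M. (\<omega>, \<omega>') \<in> H}" for \<omega>
    using emeasure_distr[OF id(1) sets_Pair1[OF H, of \<omega>]]
    by (simp add: vimage_def Int_def conj_commute)
  ultimately have meas: "(\<lambda>\<omega>. emeasure M {\<omega>' \<in> space M. (\<omega>, \<omega>') \<in> H}) \<in> borel_measurable M"
    using measurable_compose[OF id(2)] by simp
  have "emeasure M {\<omega> \<in> space M. (\<omega>, \<theta> s \<omega>) \<in> H} = 0"
    using AE by (rule emeasure_eq_0_AE)
  then have "(\<integral>\<^sup>+ \<omega>. emeasure M {\<omega>' \<in> space M. (\<omega>, \<omega>') \<in> H} \<partial>M) = 0"
    using emeasure_decouple[OF s H] by simp
  then have "AE \<omega> in M. emeasure M {\<omega>' \<in> space M. (\<omega>, \<omega>') \<in> H} = 0"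
    using nn_integral_0_iff_AE[OF meas] by simp
  then show ?thesis
  proof eventually_elim
    case (elim \<omega>)
    then show ?case
      using AE_iff_measurable[OF sets_F_infty_M[OF sec[of \<omega>]], of "\<lambda>\<omega>'. (\<omega>, \<omega>') \<notin> H"] by simp
  qed
qed

text \<open>The sets that can be approximated from the filtration are closed under complements and
  countable unions, whence the induction over \<open>sigma_sets\<close>. A countable union is first
  truncated by continuity from below; the finitely many remaining sets then share a single time, the
  maximum of theirs.\<close>

lemma F_infty_approx:
  assumes "E \<in> sets F_infty" "\<epsilon> > 0"
  shows "\<exists>s\<in>rational_times. \<exists>B\<in>sets (F s). prob (sym_diff E B) < \<epsilon>"
  using assms(1)[unfolded sets_F_infty] assms(2)
proof (induction arbitrary: \<epsilon> rule: sigma_sets.induct)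
  case (Basic E)
  then obtain t where t: "t \<in> T" "E \<in> sets (F t)" by blast
  obtain n where n: "t \<le> real n" using real_arch_simple by blast
  then have "E \<in> sets (F (real n))" using sets_F_mono[OF t(1) T_of_nat n] t(2) by blast
  then show ?case
    using Basic(2) of_nat_rational_times[of n] by (intro bexI[of _ "real n"] bexI[of _ E]) auto
next
  case Empty
  then show ?case using zero_rational_times by (intro bexI[of _ 0] bexI[of _ "{}"]) auto
next
  case (Compl E)
  then obtain s B where sB: "s \<in> rational_times" "B \<in> sets (F s)" "prob (sym_diff E B) < \<epsilon>"
    by blast
  have "E \<subseteq> space M" using Compl(1) sigma_sets_into_sp[OF Union_F_Pow] by blast
  moreover have "B \<subseteq> space M"
    using sB sets.sets_into_space space_F rational_timesD by blast
  ultimately have "sym_diff (space M - E) (space M - B) = sym_diff E B" by blast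
  moreover have "space M - B \<in> sets (F s)"
    using sB sets.compl_sets space_F rational_timesD by metis
  ultimately show ?case using sB by (metis (no_types, lifting))
next
  case (Union E)
  have EF: "E i \<in> sets F_infty" for i using Union(1) by (simp add: sets_F_infty)
  have E: "E i \<in> events" for i using EF sets_F_infty_M by blast
  have fin: "\<exists>s\<in>rational_times. \<exists>B\<in>sets (F s). prob (sym_diff (\<Union>i<n. E i) B) < \<delta>"
    if "\<delta> > 0" for n :: nat and \<delta>
    using that
  proof (induction n arbitrary: \<delta>)
    case 0
    then show ?case using zero_rational_times by (intro bexI[of _ 0] bexI[of _ "{}"]) auto
  next
    case (Suc n)
    have pos: "\<delta> / 2 > 0" using Suc(2) by simp
    obtain s B where sB: "s \<in> rational_times" "B \<in> sets (F s)"
        "prob (sym_diff (\<Union>i<n. E i) B) < \<delta> / 2"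
      using Suc(1)[OF pos] by blast
    obtain s' B' where sB': "s' \<in> rational_times" "B' \<in> sets (F s')"
        "prob (sym_diff (E n) B') < \<delta> / 2"
      using Union(2)[OF pos, of n] by blast
    define u where "u = max s s'"
    have u: "u \<in> rational_times" using sB sB' by (simp add: u_def max_def)
    have BF: "B \<in> sets (F u)" "B' \<in> sets (F u)"
      using sB sB' u sets_F_mono[of s u] sets_F_mono[of s' u] rational_timesD
      by (auto simp: u_def)
    have BM: "B \<in> events" "B' \<in> events"
      using BF u subalgebra_F[of u] rational_timesD by (auto simp: subalgebra_def)
    have "prob (sym_diff (\<Union>i<Suc n. E i) (B \<union> B')) \<le>
        prob (sym_diff (\<Union>i<n. E i) B \<union> sym_diff (E n) B')"
      using E BM by (intro finite_measure_mono) (auto simp: less_Suc_eq)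
    also have "\<dots> \<le> prob (sym_diff (\<Union>i<n. E i) B) + prob (sym_diff (E n) B')"
      using E BM by (intro measure_Un_le) auto
    also have "\<dots> < \<delta>" using sB(3) sB'(3) by simp
    finally show ?case using u BF by blast
  qed
  have "(\<lambda>n. prob (\<Union>i<n. E i)) \<longlonglongrightarrow> prob (\<Union>n. \<Union>i<n. E i)"
    using E by (intro finite_Lim_measure_incseq) (auto intro!: incseq_SucI simp: less_Suc_eq)
  moreover have "(\<Union>n. \<Union>i<n. E i) = (\<Union>i. E i)" by blast
  ultimately have lim: "(\<lambda>n. prob (\<Union>i<n. E i)) \<longlonglongrightarrow> prob (\<Union>i. E i)" by simp
  have "prob (\<Union>i. E i) - \<epsilon> / 2 < prob (\<Union>i. E i)" using Union(3) by simp
  from order_tendstoD(1)[OF lim this]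
  obtain n where n: "prob (\<Union>i. E i) - \<epsilon> / 2 < prob (\<Union>i<n. E i)"
    by (auto simp: eventually_sequentially)
  have pos: "\<epsilon> / 2 > 0" using Union(3) by simp
  obtain s B where sB: "s \<in> rational_times" "B \<in> sets (F s)"
      "prob (sym_diff (\<Union>i<n. E i) B) < \<epsilon> / 2"
    using fin[OF pos] by blast
  have BM: "B \<in> events"
    using sB subalgebra_F[of s] rational_timesD by (auto simp: subalgebra_def)
  have "prob (sym_diff (\<Union>i. E i) B) \<le>
      prob (((\<Union>i. E i) - (\<Union>i<n. E i)) \<union> sym_diff (\<Union>i<n. E i) B)"
    using E BM by (intro finite_measure_mono) auto
  also have "\<dots> \<le> prob ((\<Union>i. E i) - (\<Union>i<n. E i)) + prob (sym_diff (\<Union>i<n. E i) B)"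
    using E BM by (intro measure_Un_le) auto
  also have "prob ((\<Union>i. E i) - (\<Union>i<n. E i)) = prob (\<Union>i. E i) - prob (\<Union>i<n. E i)"
    using E by (intro finite_measure_Diff) auto
  finally have "prob (sym_diff (\<Union>i. E i) B) < \<epsilon>" using n sB(3) by simp
  then show ?case using sB by blast
qed

end

subsection \<open>Random dynamical systems on compact spaces\<close>

text \<open>A locale of its own, so that the results up to the two-point motion can be interpreted a
  second time for the motion on pairs.\<close>

locale compact_random_dynamical_system = random_dynamical_system T M F \<theta> \<phi>
  for T :: "real set" and M :: "'w measure" and F and \<theta> and
    \<phi> :: "real \<Rightarrow> 'w \<Rightarrow> 'x::metric_space \<Rightarrow> 'x" +
  assumes compact_space: "compact (UNIV :: 'x set)"
begin

abbreviation "inv_set \<equiv> forward_invariant T M \<phi>"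

lemma traj_measurable: "t \<in> T \<Longrightarrow> (\<lambda>\<omega>. \<phi> t \<omega> x) \<in> measurable (F t) borel"
  using measurable_compose[OF _ adapted, of "\<lambda>\<omega>. (\<omega>, x)" "F t" t] by simp

lemma traj_measurable_infty: "t \<in> T \<Longrightarrow> (\<lambda>\<omega>. \<phi> t \<omega> x) \<in> measurable F_infty borel"
  using traj_measurable measurable_from_subalg subalgebra_F_infty_F by blast

lemma traj_measurable_M: "t \<in> T \<Longrightarrow> (\<lambda>\<omega>. \<phi> t \<omega> x) \<in> measurable M borel"
  using traj_measurable measurable_from_subalg subalgebra_F by blast

lemma traj_joint_measurable:
  assumes "t \<in> T"
  shows "(\<lambda>(\<omega>, x). \<phi> t \<omega> x) \<in> measurable (F_infty \<Otimes>\<^sub>M borel) borel"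
proof -
  have id: "(\<lambda>\<omega>. \<omega>) \<in> measurable F_infty (F t)"
    using measurable_from_subalg[OF subalgebra_F_infty_F[OF assms] measurable_ident]
    by (simp add: id_def)
  have "(\<lambda>p. (fst p, snd p)) \<in> measurable (F_infty \<Otimes>\<^sub>M borel) (F t \<Otimes>\<^sub>M borel)"
    by (intro measurable_Pair measurable_compose[OF measurable_fst id] measurable_snd)
  from measurable_compose[OF this adapted[OF assms]] show ?thesis
    by (simp add: split_beta')
qed

lemma traj_tendsto:
  assumes "t \<in> T" "\<omega> \<in> space M" "xs \<longlonglongrightarrow> x"
  shows "(\<lambda>n. \<phi> t \<omega> (xs n)) \<longlonglongrightarrow> \<phi> t \<omega> x"
  using continuous_on_tendsto_compose[OF continuous[OF assms(1,2)] assms(3)] by simp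

lemma traj_vimage_open:
  assumes "t \<in> T" "\<omega> \<in> space M" "open U"
  shows "open (\<phi> t \<omega> -` U)"
  using continuous[OF assms(1,2)] assms(3) by (simp add: continuous_on_open_vimage)

text \<open>One sequence of times serves all \<open>x\<close>, which permits limits of distances
  between two trajectories; \<open>t \<le> ts n\<close> keeps the approximating times beyond any
  threshold that \<open>t\<close> has passed.\<close>

lemma traj_rational_approx:
  assumes "t \<in> T" "\<omega> \<in> space M"
  obtains ts where "range ts \<subseteq> rational_times" "\<And>n. t \<le> ts n"
    "\<And>x. (\<lambda>n. \<phi> (ts n) \<omega> x) \<longlonglongrightarrow> \<phi> t \<omega> x"
proof -
  obtain ts where ts: "range ts \<subseteq> rational_times" "decseq ts" "ts \<longlonglongrightarrow> t" "\<And>n. t \<le> ts n"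
    using rational_times_right_dense[OF assms(1)] by blast
  have "(\<lambda>n. \<phi> (ts n) \<omega> x) \<longlonglongrightarrow> \<phi> t \<omega> x" for x
    using right_continuous[OF assms, of ts "\<lambda>_. x"] ts rational_timesD by auto
  with ts(1,4) show ?thesis by (rule that)
qed

lemma pred_traj_in:
  assumes "t \<in> T" "S \<in> sets borel"
  shows "Measurable.pred F_infty (\<lambda>\<omega>. \<phi> t \<omega> x \<in> S)"
proof -
  note [measurable] = traj_measurable_infty[OF assms(1), of x] assms(2)
  show ?thesis by measurable
qed

lemma pred_traj_dist:
  assumes "t \<in> T"
  shows "Measurable.pred F_infty (\<lambda>\<omega>. dist (\<phi> t \<omega> x) (\<phi> t \<omega> y) \<le> \<epsilon>)"
    and "Measurable.pred F_infty (\<lambda>\<omega>. dist (\<phi> t \<omega> x) (\<phi> t \<omega> y) < \<epsilon>)"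
proof -
  have [measurable]: "(\<lambda>\<omega>. dist (\<phi> t \<omega> x) (\<phi> t \<omega> y)) \<in> borel_measurable F_infty"
    using compact_space assms by (intro borel_measurable_dist_compact traj_measurable_infty)
  show "Measurable.pred F_infty (\<lambda>\<omega>. dist (\<phi> t \<omega> x) (\<phi> t \<omega> y) \<le> \<epsilon>)"
    "Measurable.pred F_infty (\<lambda>\<omega>. dist (\<phi> t \<omega> x) (\<phi> t \<omega> y) < \<epsilon>)" by measurable
qed

lemma pred_F_inftyD:
  assumes "Measurable.pred F_infty P"
  shows "{\<omega> \<in> space M. P \<omega>} \<in> sets M"
  using sets_F_infty_M[OF predE[OF assms]] unfolding space_F_infty .

lemma prob_eq_1_iff_AE:
  "Measurable.pred F_infty P \<Longrightarrow> \<P>(\<omega> in M. P \<omega>) = 1 \<longleftrightarrow> (AE \<omega> in M. P \<omega>)"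
  by (intro prob_Collect_eq_1 pred_F_inftyD)

subsection \<open>Forward-invariant sets\<close>

text \<open>Membership in a closed set survives limits: first in time, by right-continuity, then in
  space, by continuity of \<open>\<phi> t \<omega>\<close>.\<close>

lemma traj_image_subset_iff:
  assumes \<omega>: "\<omega> \<in> space M" and C: "closed C" and D: "D \<subseteq> A" "A \<subseteq> closure D"
  shows "(\<forall>t\<in>T. \<phi> t \<omega> ` A \<subseteq> C) \<longleftrightarrow> (\<forall>t\<in>rational_times. \<forall>x\<in>D. \<phi> t \<omega> x \<in> C)"
proof
  assume R: "\<forall>t\<in>rational_times. \<forall>x\<in>D. \<phi> t \<omega> x \<in> C"
  have D': "\<phi> t \<omega> x \<in> C" if t: "t \<in> T" and x: "x \<in> D" for t x
  proof -
    obtain ts where ts: "range ts \<subseteq> rational_times"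
        "\<And>x. (\<lambda>n. \<phi> (ts n) \<omega> x) \<longlonglongrightarrow> \<phi> t \<omega> x"
      using traj_rational_approx[OF t \<omega>] by metis
    have "\<phi> (ts n) \<omega> x \<in> C" for n using R x ts(1) by blast
    from closed_sequentially[OF C this ts(2)] show ?thesis .
  qed
  show "\<forall>t\<in>T. \<phi> t \<omega> ` A \<subseteq> C"
  proof (intro ballI image_subsetI)
    fix t x assume t: "t \<in> T" and "x \<in> A"
    then obtain xs where xs: "\<And>n. xs n \<in> D" "xs \<longlonglongrightarrow> x"
      using D(2) closure_sequential[of x D] by blast
    show "\<phi> t \<omega> x \<in> C"
      using C D'[OF t xs(1)] traj_tendsto[OF t \<omega> xs(2)] by (rule closed_sequentially)
  qed
qed (use D(1) rational_timesD in blast)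

lemma pred_forward_invariant:
  assumes "closed K"
  shows "Measurable.pred F_infty (\<lambda>\<omega>. \<forall>t\<in>T. \<phi> t \<omega> ` K \<subseteq> K)"
proof -
  obtain D where D: "countable D" "D \<subseteq> K" "K \<subseteq> closure D"
    using compact_countable_dense_subset[OF compact_space] by metis
  have "Measurable.pred F_infty (\<lambda>\<omega>. \<forall>t\<in>rational_times. \<forall>x\<in>D. \<phi> t \<omega> x \<in> K)"
    using D(1) countable_rational_times assms
    by (intro measurable_pred_countable pred_traj_in) (auto dest: rational_timesD)
  then show ?thesis
    by (rule measurable_cong[THEN iffD2, rotated])
      (use traj_image_subset_iff assms D in simp)
qed

lemma forward_invariant_AE_iff:
  "closed K \<Longrightarrow> inv_set K \<longleftrightarrow> (AE \<omega> in M. \<forall>t\<in>T. \<phi> t \<omega> ` K \<subseteq> K)"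
  unfolding forward_invariant_def by (intro prob_eq_1_iff_AE pred_forward_invariant)

text \<open>The exceptional null set may depend on the point and the time, since countably many of
  both decide invariance. In this form invariance can be checked by the Markov property at one fixed
  time.\<close>

lemma forward_invariant_pointwise_iff:
  assumes "closed K"
  shows "inv_set K \<longleftrightarrow> (\<forall>x\<in>K. \<forall>t\<in>rational_times. AE \<omega> in M. \<phi> t \<omega> x \<in> K)"
proof
  assume "inv_set K"
  then have "AE \<omega> in M. \<forall>t\<in>T. \<phi> t \<omega> ` K \<subseteq> K"
    using forward_invariant_AE_iff[OF assms] by blast
  then show "\<forall>x\<in>K. \<forall>t\<in>rational_times. AE \<omega> in M. \<phi> t \<omega> x \<in> K"
    by (intro ballI) (auto dest: rational_timesD)
next
  assume R: "\<forall>x\<in>K. \<forall>t\<in>rational_times. AE \<omega> in M. \<phi> t \<omega> x \<in> K"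
  obtain D where D: "countable D" "D \<subseteq> K" "K \<subseteq> closure D"
    using compact_countable_dense_subset[OF compact_space] by metis
  have "AE \<omega> in M. \<forall>t\<in>rational_times. \<forall>x\<in>D. \<phi> t \<omega> x \<in> K"
    using R D(2) by (auto simp: AE_ball_countable D(1) countable_rational_times)
  then have "AE \<omega> in M. \<forall>t\<in>T. \<phi> t \<omega> ` K \<subseteq> K"
    using AE_space by eventually_elim (use traj_image_subset_iff assms D in simp)
  then show "inv_set K" using forward_invariant_AE_iff[OF assms] by blast
qed

lemma forward_invariant_INT:
  assumes "countable I" "\<And>i. i \<in> I \<Longrightarrow> closed (K i)" "\<And>i. i \<in> I \<Longrightarrow> inv_set (K i)"
  shows "inv_set (\<Inter>i\<in>I. K i)"
proof -
  have "closed (\<Inter>i\<in>I. K i)" using assms(2) by blast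
  moreover have "\<forall>x\<in>(\<Inter>i\<in>I. K i). \<forall>t\<in>rational_times. AE \<omega> in M. \<phi> t \<omega> x \<in> (\<Inter>i\<in>I. K i)"
    using assms forward_invariant_pointwise_iff by (auto simp: AE_ball_countable)
  ultimately show ?thesis using forward_invariant_pointwise_iff by blast
qed

lemma forward_invariant_Int:
  "closed K \<Longrightarrow> closed L \<Longrightarrow> inv_set K \<Longrightarrow> inv_set L \<Longrightarrow> inv_set (K \<inter> L)"
  using forward_invariant_INT[of "UNIV :: bool set" "\<lambda>b. if b then K else L"]
  by (simp add: UNIV_bool Int_commute)

text \<open>Running through a countable base and removing each basic open set whenever a smaller
  invariant set avoids it replaces Zorn's lemma, so that only countable intersections occur.\<close>

lemma minimal_set_exists:
  assumes "closed C" "C \<noteq> {}" "inv_set C"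
  obtains K where "K \<subseteq> C" "minimal_set T M \<phi> K"
proof -
  obtain B :: "nat \<Rightarrow> 'x set" where B: "\<And>n. open (B n)"
      "\<And>S x. open S \<Longrightarrow> x \<in> S \<Longrightarrow> \<exists>n. x \<in> B n \<and> B n \<subseteq> S"
    using compact_countable_base[OF compact_space] by blast
  define P where "P A S \<longleftrightarrow> S \<subseteq> A \<and> closed S \<and> S \<noteq> {} \<and> inv_set S" for A S
  define step where "step n A =
    (if \<exists>S. P A S \<and> S \<inter> B n = {} then SOME S. P A S \<and> S \<inter> B n = {} else A)" for n A
  define Ks where "Ks = rec_nat C step"
  have Ks0: "Ks 0 = C" and KsS: "Ks (Suc n) = step n (Ks n)" for n
    by (simp_all add: Ks_def)
  have step_P: "P A (step n A)" if "P C A" for A n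
  proof (cases "\<exists>S. P A S \<and> S \<inter> B n = {}")
    case True
    then show ?thesis unfolding step_def by (smt (verit, best) someI_ex)
  next
    case False
    then show ?thesis using that unfolding step_def P_def by auto
  qed
  have step_avoids: "step n A \<inter> B n = {}" if "\<exists>S. P A S \<and> S \<inter> B n = {}" for A n
    using someI_ex[OF that] that unfolding step_def by simp
  have Ks_P: "P C (Ks n)" for n
  proof (induction n)
    case 0
    then show ?case using assms by (simp add: Ks0 P_def)
  next
    case (Suc n)
    then show ?case using step_P[OF Suc, of n] unfolding KsS P_def by blast
  qed
  have dec: "decseq Ks"
    using step_P[OF Ks_P] by (intro decseq_SucI) (simp add: KsS P_def)
  define K where "K = (\<Inter>n. Ks n)"
  have cl: "closed K" unfolding K_def using Ks_P by (auto simp: P_def)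
  have inv: "inv_set K"
    unfolding K_def using Ks_P by (intro forward_invariant_INT) (auto simp: P_def)
  have "UNIV \<inter> (\<Inter>n\<in>UNIV. Ks n) \<noteq> {}"
  proof (rule compact_imp_fip_image[OF compact_space])
    show "closed (Ks n)" for n using Ks_P by (simp add: P_def)
    fix I :: "nat set" assume I: "finite I"
    have "Ks (Max (insert 0 I)) \<subseteq> (\<Inter>n\<in>I. Ks n)"
      using I decseqD[OF dec] by (intro INT_greatest) simp
    then show "UNIV \<inter> (\<Inter>n\<in>I. Ks n) \<noteq> {}"
      using Ks_P by (fastforce simp: P_def)
  qed
  then have ne: "K \<noteq> {}" by (simp add: K_def)
  have "L = K" if L: "L \<subseteq> K" "closed L" "inv_set L" "L \<noteq> {}" for L
  proof (rule ccontr)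
    assume "L \<noteq> K"
    then obtain x where x: "x \<in> K" "x \<in> - L" using L(1) by blast
    obtain n where n: "x \<in> B n" "B n \<subseteq> - L" using B(2)[OF _ x(2)] L(2) by auto
    \<comment> \<open>\<open>L\<close> was itself a candidate at stage \<open>n\<close>, so that
      stage passed to a set avoiding \<open>B n\<close>; yet \<open>x\<close> lies in
      \<open>B n\<close> and survives in \<open>K\<close>.\<close>
    have "P (Ks n) L" using L unfolding P_def K_def by blast
    then have "Ks (Suc n) \<inter> B n = {}" using n(2) unfolding KsS by (intro step_avoids) blast
    then show False using x(1) n(1) unfolding K_def by blast
  qed
  then have "minimal_set T M \<phi> K"
    unfolding minimal_set_def using ne cl inv by blast
  moreover have "K \<subseteq> C" using Ks0 unfolding K_def by blast
  ultimately show ?thesis by (rule that[rotated])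
qed

subsection \<open>Reaching open sets\<close>

text \<open>Lower semicontinuity by Fatou: for fixed \<open>\<omega>\<close>, the indicator of the
  open set at \<open>\<phi> t \<omega> x\<close> is at most the liminf of its values along
  \<open>xs\<close>, by continuity.\<close>

lemma open_prob_greater:
  assumes t: "t \<in> T" and U: "open U"
  shows "open {x. \<P>(\<omega> in M. \<phi> t \<omega> x \<in> U) > a}"
proof -
  have meas: "(\<lambda>\<omega>. indicator U (\<phi> t \<omega> x) :: ennreal) \<in> borel_measurable M" for x
    by (intro measurable_compose[OF traj_measurable_M[OF t]] borel_measurable_indicator borel_open U)
  have em: "emeasure M {\<omega> \<in> space M. \<phi> t \<omega> x \<in> U} = (\<integral>\<^sup>+ \<omega>. indicator U (\<phi> t \<omega> x) \<partial>M)" for x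
  proof -
    have "{\<omega> \<in> space M. \<phi> t \<omega> x \<in> U} \<in> sets M"
      by (intro pred_F_inftyD pred_traj_in t borel_open U)
    then have "emeasure M {\<omega> \<in> space M. \<phi> t \<omega> x \<in> U} =
        (\<integral>\<^sup>+ \<omega>. indicator {\<omega> \<in> space M. \<phi> t \<omega> x \<in> U} \<omega> \<partial>M)"
      by (rule nn_integral_indicator[symmetric])
    also have "\<dots> = (\<integral>\<^sup>+ \<omega>. indicator U (\<phi> t \<omega> x) \<partial>M)"
      by (intro nn_integral_cong) (simp add: indicator_def)
    finally show ?thesis .
  qed
  have "closed {x. \<P>(\<omega> in M. \<phi> t \<omega> x \<in> U) \<le> a}"
    unfolding closed_sequential_limits
  proof (intro allI impI, elim conjE)
    fix xs x assume xs: "\<forall>n. xs n \<in> {x. \<P>(\<omega> in M. \<phi> t \<omega> x \<in> U) \<le> a}" and lim: "xs \<longlonglongrightarrow> x"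
    \<comment> \<open>\<open>ennreal\<close> sends negative numbers to 0, so the sign of
      \<open>a\<close> is required to return to the reals.\<close>
    have a: "0 \<le> a" using xs order_trans[OF measure_nonneg] by blast
    have "emeasure M {\<omega> \<in> space M. \<phi> t \<omega> x \<in> U} = (\<integral>\<^sup>+ \<omega>. indicator U (\<phi> t \<omega> x) \<partial>M)"
      by (rule em)
    also have "\<dots> \<le> (\<integral>\<^sup>+ \<omega>. liminf (\<lambda>n. indicator U (\<phi> t \<omega> (xs n))) \<partial>M)"
    proof (rule nn_integral_mono)
      fix \<omega> assume \<omega>: "\<omega> \<in> space M"
      show "indicator U (\<phi> t \<omega> x) \<le> (liminf (\<lambda>n. indicator U (\<phi> t \<omega> (xs n))) :: ennreal)"
      proof (cases "\<phi> t \<omega> x \<in> U")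
        case True
        have "\<forall>\<^sub>F n in sequentially. \<phi> t \<omega> (xs n) \<in> U"
          using topological_tendstoD[OF traj_tendsto[OF t \<omega> lim] U True] .
        then have "\<forall>\<^sub>F n in sequentially. 1 \<le> (indicator U (\<phi> t \<omega> (xs n)) :: ennreal)"
          by eventually_elim simp
        then show ?thesis using True by (simp add: Liminf_bounded)
      qed simp
    qed
    also have "\<dots> \<le> liminf (\<lambda>n. \<integral>\<^sup>+ \<omega>. indicator U (\<phi> t \<omega> (xs n)) \<partial>M)"
      by (rule nn_integral_liminf) (rule meas)
    also have "\<dots> \<le> ennreal a"
      using xs by (intro Liminf_le) (auto simp: em[symmetric] emeasure_eq_measure intro!: ennreal_leI always_eventually)
    finally show "x \<in> {x. \<P>(\<omega> in M. \<phi> t \<omega> x \<in> U) \<le> a}"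
      using a by (simp add: emeasure_eq_measure)
  qed
  moreover have "{x. \<P>(\<omega> in M. \<phi> t \<omega> x \<in> U) > a} = - {x. \<P>(\<omega> in M. \<phi> t \<omega> x \<in> U) \<le> a}"
    by auto
  ultimately show ?thesis by (simp add: open_Compl)
qed

text \<open>The Markov property on an event of \<open>F s\<close>. It is
  \<open>emeasure_decouple\<close> with the restriction to \<open>B\<close> built into
  \<open>H\<close>, which is admissible because the position at time \<open>s\<close> is determined
  by \<open>F s\<close>.\<close>

lemma emeasure_markov:
  assumes s: "s \<in> T" and B: "B \<in> sets (F s)" and G: "G \<in> sets (F_infty \<Otimes>\<^sub>M borel)"
  shows "emeasure M {\<omega> \<in> B. (\<theta> s \<omega>, \<phi> s \<omega> x) \<in> G} =
    (\<integral>\<^sup>+ \<omega>. emeasure M {\<omega>' \<in> space M. (\<omega>', \<phi> s \<omega> x) \<in> G} * indicator B \<omega> \<partial>M)"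
proof -
  define H where "H = (\<lambda>(\<omega>, \<omega>'). (\<omega>', \<phi> s \<omega> x)) -` G \<inter> space (F s \<Otimes>\<^sub>M F_infty) \<inter>
    (B \<times> space F_infty)"
  have "(\<lambda>p. (snd p, \<phi> s (fst p) x)) \<in> measurable (F s \<Otimes>\<^sub>M F_infty) (F_infty \<Otimes>\<^sub>M borel)"
    by (intro measurable_Pair measurable_snd measurable_compose[OF measurable_fst]
        traj_measurable s)
  then have H: "H \<in> sets (F s \<Otimes>\<^sub>M F_infty)"
    unfolding H_def using G B
    by (intro sets.Int measurable_sets[OF _ G] pair_measureI sets.top) (auto simp: split_beta')
  have BM: "B \<subseteq> space M" using B sets.sets_into_space space_F[OF s] by blast
  have "{\<omega> \<in> B. (\<theta> s \<omega>, \<phi> s \<omega> x) \<in> G} = {\<omega> \<in> space M. (\<omega>, \<theta> s \<omega>) \<in> H}"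
    using BM measurable_space[OF shift_measurable[OF s]]
    by (auto simp: H_def space_pair_measure space_F[OF s])
  then have "emeasure M {\<omega> \<in> B. (\<theta> s \<omega>, \<phi> s \<omega> x) \<in> G} =
      (\<integral>\<^sup>+ \<omega>. emeasure M {\<omega>' \<in> space M. (\<omega>, \<omega>') \<in> H} \<partial>M)"
    using emeasure_decouple[OF s H] by simp
  also have "\<dots> = (\<integral>\<^sup>+ \<omega>. emeasure M {\<omega>' \<in> space M. (\<omega>', \<phi> s \<omega> x) \<in> G} * indicator B \<omega> \<partial>M)"
    using BM
    by (intro nn_integral_cong)
      (auto simp: H_def space_pair_measure space_F[OF s] split: split_indicator
        intro!: arg_cong[where f = "emeasure M"])
  finally show ?thesis .
qed

text \<open>The hypothesis speaks of every minimal set, so that the lemma applies both to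
  \<open>\<phi>\<close>, where uniqueness of \<open>K\<close> supplies it, and to the two-point
  motion, where it comes from the diagonal.\<close>

lemma reachable:
  assumes U: "open U" and meets: "\<And>K. minimal_set T M \<phi> K \<Longrightarrow> K \<inter> U \<noteq> {}"
  shows "\<exists>t\<in>rational_times. \<P>(\<omega> in M. \<phi> t \<omega> x \<in> U) > 0"
proof (rule ccontr)
  assume x: "\<not> ?thesis"
  define C where "C = (\<Inter>t\<in>rational_times. - {x. \<P>(\<omega> in M. \<phi> t \<omega> x \<in> U) > 0})"
  have C_iff: "y \<in> C \<longleftrightarrow> (\<forall>t\<in>rational_times. AE \<omega> in M. \<phi> t \<omega> y \<notin> U)" for y
  proof -
    have "\<P>(\<omega> in M. \<phi> t \<omega> y \<in> U) = 0 \<longleftrightarrow> (AE \<omega> in M. \<phi> t \<omega> y \<notin> U)"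
      if "t \<in> rational_times" for t
      using U rational_timesD[OF that] by (intro prob_Collect_eq_0 pred_F_inftyD pred_traj_in) auto
    then show ?thesis unfolding C_def by (simp add: zero_less_measure_iff)
  qed
  have closed: "closed C"
    unfolding C_def using U open_prob_greater rational_timesD
    by (intro closed_INT ballI) (simp add: closed_Compl)
  have "inv_set C"
    unfolding forward_invariant_pointwise_iff[OF closed]
  proof (intro ballI)
    fix y s assume y: "y \<in> C" and s: "s \<in> rational_times"
    note sT = rational_timesD[OF s]
    have "AE \<omega> in M. AE \<omega>' in M. \<phi> t \<omega>' (\<phi> s \<omega> y) \<notin> U" if t: "t \<in> rational_times" for t
    proof -
      note tT = rational_timesD[OF t]
      define H where "H = (\<lambda>p. \<phi> t (snd p) (\<phi> s (fst p) y)) -` U \<inter> space (F s \<Otimes>\<^sub>M F_infty)"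
      have "(\<lambda>p. (snd p, \<phi> s (fst p) y)) \<in> measurable (F s \<Otimes>\<^sub>M F_infty) (F_infty \<Otimes>\<^sub>M borel)"
        by (intro measurable_Pair measurable_snd measurable_compose[OF measurable_fst]
            traj_measurable sT)
      from measurable_compose[OF this traj_joint_measurable[OF tT]]
      have H: "H \<in> sets (F s \<Otimes>\<^sub>M F_infty)"
        unfolding H_def using U by (intro measurable_sets) auto
      \<comment> \<open>By the cocycle property, missing \<open>U\<close> at time
        \<open>s + t\<close> from \<open>y\<close> means missing it at time \<open>t\<close> from
        \<open>\<phi> s \<omega> y\<close> under the shifted noise, which decoupling replaces by an
        independent copy.\<close>
      have "AE \<omega> in M. \<phi> (s + t) \<omega> y \<notin> U"
        using y s t rational_times_add unfolding C_iff by blast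
      then have "AE \<omega> in M. (\<omega>, \<theta> s \<omega>) \<notin> H"
        using AE_space by eventually_elim (simp add: H_def cocycle[OF sT tT])
      from AE_decouple[OF sT H this] show ?thesis
      proof (rule AE_mp[OF _ AE_I2[OF impI]])
        fix \<omega> assume "\<omega> \<in> space M" "AE \<omega>' in M. (\<omega>, \<omega>') \<notin> H"
        from this(2) AE_space show "AE \<omega>' in M. \<phi> t \<omega>' (\<phi> s \<omega> y) \<notin> U"
          by eventually_elim
            (use \<open>\<omega> \<in> space M\<close> in \<open>simp add: H_def space_pair_measure space_F[OF sT]\<close>)
      qed
    qed
    then have "AE \<omega> in M. \<forall>t\<in>rational_times. AE \<omega>' in M. \<phi> t \<omega>' (\<phi> s \<omega> y) \<notin> U"
      by (simp add: AE_ball_countable countable_rational_times)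
    then show "AE \<omega> in M. \<phi> s \<omega> y \<in> C" unfolding C_iff .
  qed
  moreover have "x \<in> C" using x unfolding C_def by simp
  ultimately obtain K where K: "K \<subseteq> C" "minimal_set T M \<phi> K"
    using minimal_set_exists[OF closed] by blast
  then obtain y where "y \<in> C" "y \<in> U" using meets by blast
  \<comment> \<open>Time 0 is among the attempts, so no point of \<open>U\<close> can lie in
    \<open>C\<close>.\<close>
  then have "AE \<omega> in M. \<phi> 0 \<omega> y \<notin> U" using zero_rational_times unfolding C_iff by blast
  then have "AE \<omega> in M. False"
    using AE_space by eventually_elim (use \<open>y \<in> U\<close> zero in simp)
  then show False by simp
qed

text \<open>The sets \<open>R n\<close> are open by lower semicontinuity, so finitely many cover the
  compact space, and the largest index occurring gives \<open>\<delta>\<close>. The time may still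
  vary with \<open>x\<close>.\<close>

lemma uniformly_reachable:
  assumes U: "open U" and reach: "\<And>x. \<exists>t\<in>rational_times. \<P>(\<omega> in M. \<phi> t \<omega> x \<in> U) > 0"
  obtains \<delta> where "\<delta> > 0" "\<And>x. \<exists>t\<in>rational_times. \<P>(\<omega> in M. \<phi> t \<omega> x \<in> U) > \<delta>"
proof -
  define R where "R n = (\<Union>t\<in>rational_times. {x. \<P>(\<omega> in M. \<phi> t \<omega> x \<in> U) > inverse (real (Suc n))})"
    for n
  have op: "open (R n)" for n
    unfolding R_def using U rational_timesD by (intro open_UN ballI open_prob_greater) auto
  have cover: "UNIV \<subseteq> (\<Union>n\<in>UNIV. R n)"
  proof
    fix x
    obtain t where t: "t \<in> rational_times" "\<P>(\<omega> in M. \<phi> t \<omega> x \<in> U) > 0" using reach by blast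
    obtain n where "inverse (real (Suc n)) < \<P>(\<omega> in M. \<phi> t \<omega> x \<in> U)"
      using reals_Archimedean[OF t(2)] by blast
    then show "x \<in> (\<Union>n\<in>UNIV. R n)" using t(1) unfolding R_def by blast
  qed
  obtain N where N: "finite N" "UNIV \<subseteq> (\<Union>n\<in>N. R n)"
    by (rule compactE_image[OF compact_space _ cover]) (use op in auto)
  define \<delta> where "\<delta> = inverse (real (Suc (Max (insert 0 N))))"
  have "\<exists>t\<in>rational_times. \<P>(\<omega> in M. \<phi> t \<omega> x \<in> U) > \<delta>" for x
  proof -
    obtain n t where n: "n \<in> N" "t \<in> rational_times"
        "\<P>(\<omega> in M. \<phi> t \<omega> x \<in> U) > inverse (real (Suc n))"
      using N(2) unfolding R_def by blast
    have "n \<le> Max (insert 0 N)" using N(1) n(1) by simp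
    then have "\<delta> \<le> inverse (real (Suc n))"
      unfolding \<delta>_def by (intro le_imp_inverse_le) simp_all
    then show ?thesis using n(2,3) by force
  qed
  moreover have "\<delta> > 0" unfolding \<delta>_def by simp
  ultimately show ?thesis using that by blast
qed

text \<open>The event \<open>N x\<close> that no attempt succeeds has probability at most \<open>1 - \<eta>\<close> for every \<open>x\<close> and is
  contained in \<open>{\<omega>. \<theta> s \<omega> \<in> N (\<phi> s \<omega> x)}\<close>. Hence \<open>prob (B \<inter> N x) \<le> (1 - \<eta>) * prob B\<close> for every
  \<open>B\<close> in some \<open>F s\<close>, and letting \<open>B\<close> approximate \<open>N x\<close> forces \<open>prob (N x) = 0\<close>.\<close>

lemma reach_then_event_AE:
  assumes U: "open U" and reach: "\<And>x. \<exists>t\<in>rational_times. \<P>(\<omega> in M. \<phi> t \<omega> x \<in> U) > 0"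
    and E: "E \<in> sets F_infty" "prob E > 0"
  shows "AE \<omega> in M. \<exists>t\<in>rational_times. \<phi> t \<omega> x \<in> U \<and> \<theta> t \<omega> \<in> E"
proof -
  \<comment> \<open>Failure as a joint condition on noise and starting point: the Markov property is
    to be applied with the random starting point \<open>\<phi> s \<omega> x\<close>.\<close>
  define G where "G = {p \<in> space (F_infty \<Otimes>\<^sub>M borel).
    \<not> (\<exists>t\<in>rational_times. \<phi> t (fst p) (snd p) \<in> U \<and> \<theta> t (fst p) \<in> E)}"
  define N where "N x = {\<omega> \<in> space M. (\<omega>, x) \<in> G}" for x
  have G: "G \<in> sets (F_infty \<Otimes>\<^sub>M borel)"
  proof -
    have "Measurable.pred (F_infty \<Otimes>\<^sub>M borel) (\<lambda>p. \<phi> t (fst p) (snd p) \<in> U)"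
      if t: "t \<in> rational_times" for t
      by (rule pred_sets2[OF borel_open[OF U]])
        (use traj_joint_measurable[OF rational_timesD[OF t]] in \<open>simp add: split_beta'\<close>)
    moreover have "Measurable.pred (F_infty \<Otimes>\<^sub>M borel) (\<lambda>p. \<theta> t (fst p) \<in> E)"
      if t: "t \<in> rational_times" for t
      by (rule pred_sets2[OF E(1)])
        (rule measurable_compose[OF measurable_fst shift_measurable_infty[OF rational_timesD[OF t]]])
    ultimately have "Measurable.pred (F_infty \<Otimes>\<^sub>M borel)
        (\<lambda>p. \<not> (\<exists>t\<in>rational_times. \<phi> t (fst p) (snd p) \<in> U \<and> \<theta> t (fst p) \<in> E))"
      using countable_rational_times
      by (intro pred_intros_logic measurable_pred_countable) auto
    then show ?thesis unfolding G_def by (rule predE)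
  qed
  have N_iff: "\<omega> \<in> N x \<longleftrightarrow> \<omega> \<in> space M \<and> \<not> (\<exists>t\<in>rational_times. \<phi> t \<omega> x \<in> U \<and> \<theta> t \<omega> \<in> E)" for \<omega> x
    by (simp add: N_def G_def space_pair_measure)
  have N: "N x \<in> sets F_infty" for x
  proof -
    have "N x = (\<lambda>\<omega>. (\<omega>, x)) -` G \<inter> space F_infty" by (auto simp: N_def)
    then show ?thesis using measurable_sets[OF measurable_Pair2'[of x borel F_infty] G] by simp
  qed
  have N_shift: "(\<theta> s \<omega>, \<phi> s \<omega> x) \<in> G" if \<omega>: "\<omega> \<in> N x" and s: "s \<in> rational_times" for \<omega> x s
  proof -
    have \<omega>M: "\<omega> \<in> space M" using \<omega> by (simp add: N_iff)
    have "\<theta> s \<omega> \<in> N (\<phi> s \<omega> x)"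
      unfolding N_iff
    proof (intro conjI notI)
      show "\<theta> s \<omega> \<in> space M"
        using measurable_space[OF shift_measurable[OF rational_timesD[OF s]] \<omega>M] .
      assume "\<exists>t\<in>rational_times. \<phi> t (\<theta> s \<omega>) (\<phi> s \<omega> x) \<in> U \<and> \<theta> t (\<theta> s \<omega>) \<in> E"
      then obtain t where t: "t \<in> rational_times" "\<phi> t (\<theta> s \<omega>) (\<phi> s \<omega> x) \<in> U" "\<theta> t (\<theta> s \<omega>) \<in> E"
        by blast
      then have "\<phi> (s + t) \<omega> x \<in> U" "\<theta> (s + t) \<omega> \<in> E"
        using cocycle[of s t \<omega>] shift_add[of t s \<omega>] s \<omega>M rational_timesD
        by (simp_all add: add.commute)
      then show False using \<omega> rational_times_add[OF s t(1)] unfolding N_iff by blast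
    qed
    then show ?thesis by (simp add: N_def)
  qed
  obtain \<delta> where \<delta>: "\<delta> > 0" "\<And>x. \<exists>t\<in>rational_times. \<P>(\<omega> in M. \<phi> t \<omega> x \<in> U) > \<delta>"
    using uniformly_reachable[OF U reach] by blast
  \<comment> \<open>The chance of one attempt: \<open>U\<close> is hit at a suitable time
    \<open>t\<close> with probability above \<open>\<delta>\<close>, and independently of this the
    shifted noise lies in \<open>E\<close>.\<close>
  define \<eta> where "\<eta> = \<delta> * prob E"
  have \<eta>: "\<eta> > 0" using \<delta> E by (simp add: \<eta>_def)
  have bound: "prob (N x) \<le> 1 - \<eta>" for x
  proof -
    obtain t where t: "t \<in> rational_times" "\<P>(\<omega> in M. \<phi> t \<omega> x \<in> U) > \<delta>" using \<delta>(2) by blast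
    note tT = rational_timesD[OF t(1)]
    define A where "A = {\<omega> \<in> space M. \<phi> t \<omega> x \<in> U}"
    define A' where "A' = \<theta> t -` E \<inter> space M"
    have "A = (\<lambda>\<omega>. \<phi> t \<omega> x) -` U \<inter> space (F t)" by (auto simp: A_def space_F[OF tT])
    then have A: "A \<in> sets (F t)" using traj_measurable[OF tT] U by (simp add: measurable_sets)
    have A': "A' \<in> sets F_infty"
      unfolding A'_def using measurable_sets[OF shift_measurable_infty[OF tT] E(1)] by simp
    have "prob (A \<inter> A') = prob A * prob A'"
      using memoryless[OF tT]
      by (rule indep_setD) (use A A'_def E(1) in \<open>auto simp: sets_F_infty\<close>)
    moreover have "prob A' = prob E"
      unfolding A'_def measure_def using emeasure_shift[OF tT E(1)] by simp
    ultimately have "\<eta> \<le> prob (A \<inter> A')"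
      unfolding \<eta>_def using t(2) E(2) by (simp add: A_def mult_right_mono)
    moreover have AM: "A \<inter> A' \<in> events"
      using A subalgebra_F[OF tT] sets_F_infty_M[OF A'] by (auto simp: subalgebra_def)
    moreover have "prob (N x) \<le> prob (space M - A \<inter> A')"
      using AM t(1) by (intro finite_measure_mono) (auto simp: N_iff A_def A'_def)
    ultimately show ?thesis using prob_compl[OF AM] by simp
  qed
  have "prob (N x) \<le> 0"
  proof (rule ccontr)
    assume "\<not> prob (N x) \<le> 0"
    then have p: "prob (N x) > 0" by simp
    \<comment> \<open>Replacing \<open>N x\<close> by \<open>B\<close> and back costs at most
      \<open>2 * \<epsilon>\<close> in all, while the gain is \<open>\<eta> * prob (N x)\<close>,
      which this choice makes \<open>3 * \<epsilon>\<close>.\<close>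
    define \<epsilon> where "\<epsilon> = \<eta> * prob (N x) / 3"
    have \<epsilon>: "\<epsilon> > 0" using p \<eta> by (simp add: \<epsilon>_def)
    obtain s B where sB: "s \<in> rational_times" "B \<in> sets (F s)" "prob (sym_diff (N x) B) < \<epsilon>"
      using F_infty_approx[OF N \<epsilon>] by blast
    note sT = rational_timesD[OF sB(1)]
    have BM: "B \<in> events" using sB(2) subalgebra_F[OF sT] by (auto simp: subalgebra_def)
    have NM: "N x \<in> events" using N by (rule sets_F_infty_M)
    have "emeasure M (B \<inter> N x) \<le> emeasure M {\<omega> \<in> B. (\<theta> s \<omega>, \<phi> s \<omega> x) \<in> G}"
    proof (rule emeasure_mono)
      show "B \<inter> N x \<subseteq> {\<omega> \<in> B. (\<theta> s \<omega>, \<phi> s \<omega> x) \<in> G}" using N_shift sB(1) by blast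
      have "(\<lambda>\<omega>. (\<theta> s \<omega>, \<phi> s \<omega> x)) \<in> measurable M (F_infty \<Otimes>\<^sub>M borel)"
        by (intro measurable_Pair shift_measurable_M_infty traj_measurable_M sT)
      from sets.Int[OF BM measurable_sets[OF this G]]
      have "B \<inter> ((\<lambda>\<omega>. (\<theta> s \<omega>, \<phi> s \<omega> x)) -` G \<inter> space M) \<in> events" .
      moreover have "B \<inter> ((\<lambda>\<omega>. (\<theta> s \<omega>, \<phi> s \<omega> x)) -` G \<inter> space M) =
          {\<omega> \<in> B. (\<theta> s \<omega>, \<phi> s \<omega> x) \<in> G}"
        using sets.sets_into_space[OF BM] by auto
      ultimately show "{\<omega> \<in> B. (\<theta> s \<omega>, \<phi> s \<omega> x) \<in> G} \<in> events" by metis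
    qed
    also have "\<dots> = (\<integral>\<^sup>+ \<omega>. emeasure M (N (\<phi> s \<omega> x)) * indicator B \<omega> \<partial>M)"
      using emeasure_markov[OF sT sB(2) G] by (simp add: N_def)
    also have "\<dots> \<le> (\<integral>\<^sup>+ \<omega>. ennreal (1 - \<eta>) * indicator B \<omega> \<partial>M)"
      using bound
      by (intro nn_integral_mono mult_right_mono) (auto simp: emeasure_eq_measure intro!: ennreal_leI)
    also have "\<dots> = ennreal (1 - \<eta>) * emeasure M B"
      using BM by (rule nn_integral_cmult_indicator)
    \<comment> \<open>The cited chain supplies \<open>0 \<le> 1 - \<eta>\<close>: this number bounds
      a probability from above.\<close>
    finally have "prob (B \<inter> N x) \<le> (1 - \<eta>) * prob B"
      using order_trans[OF measure_nonneg bound]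
      by (simp add: emeasure_eq_measure flip: ennreal_mult)
    moreover have "prob (N x) \<le> prob (B \<inter> N x) + prob (sym_diff (N x) B)"
      using BM NM by (intro order_trans[OF finite_measure_mono measure_Un_le]) auto
    moreover have "prob B \<le> prob (N x) + prob (sym_diff (N x) B)"
      using BM NM by (intro order_trans[OF finite_measure_mono measure_Un_le]) auto
    then have "(1 - \<eta>) * prob B \<le> (1 - \<eta>) * (prob (N x) + \<epsilon>)"
      using order_trans[OF measure_nonneg bound] sB(3) by (intro mult_left_mono) auto
    ultimately have "prob (N x) - \<epsilon> \<le> (1 - \<eta>) * (prob (N x) + \<epsilon>)" using sB(3) by linarith
    then have "\<eta> * prob (N x) + \<eta> * \<epsilon> \<le> 2 * \<epsilon>" by (simp add: algebra_simps)
    moreover have "\<eta> * prob (N x) = 3 * \<epsilon>" by (simp add: \<epsilon>_def)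
    moreover have "\<eta> * \<epsilon> > 0" using \<eta> \<epsilon> by simp
    ultimately show False using \<epsilon> by linarith
  qed
  then have "prob (N x) = 0" by (simp add: measure_le_0_iff)
  then have "AE \<omega> in M. \<omega> \<notin> N x" using prob_eq_0 sets_F_infty_M[OF N] by blast
  then show ?thesis using AE_space by eventually_elim (simp add: N_iff)
qed

subsection \<open>Contraction\<close>

text \<open>Tolerance and threshold become naturals and the diameter becomes pairwise distances, a
  first step towards countable quantifiers. Compactness makes all images bounded, so that diameters
  do control distances.\<close>

lemma contracts_iff:
  "contracts T \<phi> \<omega> A \<longleftrightarrow>
    (\<forall>k. \<exists>n. \<forall>t\<in>T. real n \<le> t \<longrightarrow> (\<forall>a\<in>A. \<forall>b\<in>A. dist (\<phi> t \<omega> a) (\<phi> t \<omega> b) \<le> inverse (real (Suc k))))"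
    (is "_ \<longleftrightarrow> (\<forall>k. \<exists>n. ?P k n)")
proof
  assume L: "contracts T \<phi> \<omega> A"
  show "\<forall>k. \<exists>n. ?P k n"
  proof
    fix k
    have "eventually (\<lambda>t. diameter (\<phi> t \<omega> ` A) < inverse (real (Suc k))) (inf at_top (principal T))"
      using L unfolding contracts_def by (rule order_tendstoD) simp
    then obtain u where u: "\<And>t. u \<le> t \<Longrightarrow> t \<in> T \<Longrightarrow> diameter (\<phi> t \<omega> ` A) < inverse (real (Suc k))"
      unfolding eventually_inf_principal eventually_at_top_linorder by blast
    obtain n where n: "u \<le> real n" using real_arch_simple by blast
    have bounded: "bounded (\<phi> t \<omega> ` A)" for t
      using compact_imp_bounded[OF compact_space] bounded_subset by blast
    have "?P k n"
    proof (intro ballI impI)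
      fix t a b assume "t \<in> T" "real n \<le> t" "a \<in> A" "b \<in> A"
      then show "dist (\<phi> t \<omega> a) (\<phi> t \<omega> b) \<le> inverse (real (Suc k))"
        using diameter_bounded_bound[OF bounded[of t], of "\<phi> t \<omega> a" "\<phi> t \<omega> b"] u[of t] n by simp
    qed
    then show "\<exists>n. ?P k n" by blast
  qed
next
  assume R: "\<forall>k. \<exists>n. ?P k n"
  show "contracts T \<phi> \<omega> A"
    unfolding contracts_def
  proof (rule tendstoI)
    fix e :: real assume "e > 0"
    then obtain k where k: "inverse (real (Suc k)) < e" using reals_Archimedean by blast
    obtain n where n: "?P k n" using R by blast
    have "dist (diameter (\<phi> t \<omega> ` A)) 0 < e" if t: "t \<in> T" "real n \<le> t" for t
    proof -
      have "diameter (\<phi> t \<omega> ` A) \<le> inverse (real (Suc k))"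
        using n t by (auto simp: diameter_def intro!: cSUP_least)
      moreover have "0 \<le> diameter (\<phi> t \<omega> ` A)"
        using compact_imp_bounded[OF compact_space] bounded_subset by (blast intro: diameter_ge_0)
      ultimately show ?thesis using k by simp
    qed
    then show "eventually (\<lambda>t. dist (diameter (\<phi> t \<omega> ` A)) 0 < e) (inf at_top (principal T))"
      unfolding eventually_inf_principal eventually_at_top_linorder by blast
  qed
qed

text \<open>The inequality is non-strict and so passes to limits in time and in space; as times are
  approximated from above, the threshold \<open>n\<close> is respected.\<close>

lemma contracts_iff_countable:
  assumes \<omega>: "\<omega> \<in> space M" and D: "D \<subseteq> A" "A \<subseteq> closure D"
  shows "contracts T \<phi> \<omega> A \<longleftrightarrow>
    (\<forall>k. \<exists>n. \<forall>t\<in>{t \<in> rational_times. real n \<le> t}. \<forall>a\<in>D. \<forall>b\<in>D.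
      dist (\<phi> t \<omega> a) (\<phi> t \<omega> b) \<le> inverse (real (Suc k)))"
proof -
  have "(\<forall>t\<in>T. real n \<le> t \<longrightarrow> (\<forall>a\<in>A. \<forall>b\<in>A. dist (\<phi> t \<omega> a) (\<phi> t \<omega> b) \<le> e)) \<longleftrightarrow>
      (\<forall>t\<in>{t \<in> rational_times. real n \<le> t}. \<forall>a\<in>D. \<forall>b\<in>D. dist (\<phi> t \<omega> a) (\<phi> t \<omega> b) \<le> e)"
    (is "?L \<longleftrightarrow> ?R") for n and e :: real
  proof
    show "?L \<Longrightarrow> ?R" using D(1) rational_timesD by blast
    assume R: ?R
    have D': "dist (\<phi> t \<omega> a) (\<phi> t \<omega> b) \<le> e"
      if t: "t \<in> T" "real n \<le> t" and ab: "a \<in> D" "b \<in> D" for t a b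
    proof -
      obtain ts where ts: "range ts \<subseteq> rational_times" "\<And>n. t \<le> ts n"
          "\<And>x. (\<lambda>n. \<phi> (ts n) \<omega> x) \<longlonglongrightarrow> \<phi> t \<omega> x"
        using traj_rational_approx[OF t(1) \<omega>] by metis
      have "dist (\<phi> (ts m) \<omega> a) (\<phi> (ts m) \<omega> b) \<le> e" for m
        using R ab ts(1) order_trans[OF t(2) ts(2)] by blast
      then show ?thesis
        using tendsto_dist[OF ts(3)[of a] ts(3)[of b]] by (intro LIMSEQ_le_const2) auto
    qed
    show ?L
    proof (intro ballI impI)
      fix t a b assume t: "t \<in> T" "real n \<le> t" and "a \<in> A" "b \<in> A"
      then have "a \<in> closure D" "b \<in> closure D" using D(2) by auto
      then obtain as bs where as: "\<And>m. as m \<in> D" "as \<longlonglongrightarrow> a" and bs: "\<And>m. bs m \<in> D" "bs \<longlonglongrightarrow> b"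
        unfolding closure_sequential by blast
      show "dist (\<phi> t \<omega> a) (\<phi> t \<omega> b) \<le> e"
        using tendsto_dist[OF traj_tendsto[OF t(1) \<omega> as(2)] traj_tendsto[OF t(1) \<omega> bs(2)]]
          D'[OF t as(1) bs(1)]
        by (intro LIMSEQ_le_const2) auto
    qed
  qed
  then show ?thesis unfolding contracts_iff by simp
qed

lemma pred_contracts: "Measurable.pred F_infty (\<lambda>\<omega>. contracts T \<phi> \<omega> A)"
proof -
  obtain D where D: "countable D" "D \<subseteq> A" "A \<subseteq> closure D"
    using compact_countable_dense_subset[OF compact_space] by metis
  have "countable {t \<in> rational_times. real n \<le> t}" for n
    using countable_rational_times by (rule countable_subset[rotated]) blast
  then have "Measurable.pred F_infty (\<lambda>\<omega>. \<forall>k. \<exists>n. \<forall>t\<in>{t \<in> rational_times. real n \<le> t}. \<forall>a\<in>D. \<forall>b\<in>D.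
      dist (\<phi> t \<omega> a) (\<phi> t \<omega> b) \<le> inverse (real (Suc k)))"
    using D(1)
    by (intro pred_intros_countable measurable_pred_countable pred_traj_dist)
      (auto dest: rational_timesD)
  then show ?thesis
    by (rule measurable_cong[THEN iffD2, rotated])
      (use contracts_iff_countable D in simp)
qed

lemma contracts_mono: "A \<subseteq> B \<Longrightarrow> contracts T \<phi> \<omega> B \<Longrightarrow> contracts T \<phi> \<omega> A"
  unfolding contracts_iff by (meson subsetD)

text \<open>From time \<open>s\<close> on, the cocycle property makes the images of \<open>A\<close>
  subsets of the images of \<open>U\<close> under the shifted noise. A hit of \<open>U\<close>
  followed by contracting noise is thereby converted into contraction from time 0.\<close>

lemma contracts_pullback:
  assumes \<omega>: "\<omega> \<in> space M" and s: "s \<in> T" and c: "contracts T \<phi> (\<theta> s \<omega>) U"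
    and A: "\<phi> s \<omega> ` A \<subseteq> U"
  shows "contracts T \<phi> \<omega> A"
  unfolding contracts_iff
proof
  fix k
  obtain n where n: "\<And>t a b. t \<in> T \<Longrightarrow> real n \<le> t \<Longrightarrow> a \<in> U \<Longrightarrow> b \<in> U \<Longrightarrow>
      dist (\<phi> t (\<theta> s \<omega>) a) (\<phi> t (\<theta> s \<omega>) b) \<le> inverse (real (Suc k))"
    using c unfolding contracts_iff by blast
  obtain m where m: "s \<le> real m" using real_arch_simple by blast
  have "dist (\<phi> t \<omega> a) (\<phi> t \<omega> b) \<le> inverse (real (Suc k))"
    if t: "t \<in> T" "real (n + m) \<le> t" and ab: "a \<in> A" "b \<in> A" for t a b
  proof -
    have st: "s \<le> t" using t m by simp
    have "\<phi> t \<omega> = \<phi> (t - s) (\<theta> s \<omega>) \<circ> \<phi> s \<omega>"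
      using cocycle[OF s T_diff[OF s t(1) st] \<omega>] by simp
    then show ?thesis
      using n[OF T_diff[OF s t(1) st], of "\<phi> s \<omega> a" "\<phi> s \<omega> b"] t m ab A by auto
  qed
  then show "\<exists>n. \<forall>t\<in>T. real n \<le> t \<longrightarrow>
      (\<forall>a\<in>A. \<forall>b\<in>A. dist (\<phi> t \<omega> a) (\<phi> t \<omega> b) \<le> inverse (real (Suc k)))" by blast
qed

lemma contracts_dist_less:
  assumes "contracts T \<phi> \<omega> A" "\<epsilon> > 0"
  obtains t where "t \<in> T" "\<And>a b. a \<in> A \<Longrightarrow> b \<in> A \<Longrightarrow> dist (\<phi> t \<omega> a) (\<phi> t \<omega> b) < \<epsilon>"
proof -
  obtain k where k: "inverse (real (Suc k)) < \<epsilon>" using assms(2) reals_Archimedean by blast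
  obtain n where "\<forall>t\<in>T. real n \<le> t \<longrightarrow>
      (\<forall>a\<in>A. \<forall>b\<in>A. dist (\<phi> t \<omega> a) (\<phi> t \<omega> b) \<le> inverse (real (Suc k)))"
    using assms(1) unfolding contracts_iff by blast
  with k T_of_nat[of n] show ?thesis by (intro that[of "real n"]) force+
qed

text \<open>Contraction passes to subsets, so neighbourhoods can be shrunk to base sets. Stability
  thus becomes a countable union of contraction events, and the quantifier over points of
  \<open>K\<close> a condition on which base sets meet \<open>K\<close>.\<close>

lemma asymptotically_stable_base_iff:
  assumes B: "\<And>n. open (B n)" "\<And>S x. open S \<Longrightarrow> x \<in> S \<Longrightarrow> \<exists>n. x \<in> B n \<and> B n \<subseteq> S"
  shows "asymptotically_stable T \<phi> \<omega> x \<longleftrightarrow> (\<exists>n::nat. x \<in> B n \<and> contracts T \<phi> \<omega> (B n))"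
proof
  assume "asymptotically_stable T \<phi> \<omega> x"
  then obtain A where A: "x \<in> interior A" "contracts T \<phi> \<omega> A"
    unfolding asymptotically_stable_def by blast
  then obtain n where "x \<in> B n" "B n \<subseteq> A"
    using B(2)[OF open_interior A(1)] interior_subset by blast
  then show "\<exists>n. x \<in> B n \<and> contracts T \<phi> \<omega> (B n)" using contracts_mono A(2) by blast
next
  assume "\<exists>n. x \<in> B n \<and> contracts T \<phi> \<omega> (B n)"
  then show "asymptotically_stable T \<phi> \<omega> x"
    unfolding asymptotically_stable_def using interior_open[OF B(1)] by metis
qed

lemma pred_ex_asymptotically_stable:
  "Measurable.pred F_infty (\<lambda>\<omega>. \<exists>x\<in>K. asymptotically_stable T \<phi> \<omega> x)"
proof -
  obtain B :: "nat \<Rightarrow> 'x set" where B: "\<And>n. open (B n)"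
      "\<And>S x. open S \<Longrightarrow> x \<in> S \<Longrightarrow> \<exists>n. x \<in> B n \<and> B n \<subseteq> S"
    using compact_countable_base[OF compact_space] by blast
  have "(\<exists>x\<in>K. asymptotically_stable T \<phi> \<omega> x) \<longleftrightarrow>
      (\<exists>n\<in>{n. K \<inter> B n \<noteq> {}}. contracts T \<phi> \<omega> (B n))" for \<omega>
    using asymptotically_stable_base_iff[of B, OF B] by blast
  moreover have "Measurable.pred F_infty (\<lambda>\<omega>. \<exists>n\<in>{n. K \<inter> B n \<noteq> {}}. contracts T \<phi> \<omega> (B n))"
    by (intro measurable_pred_countable pred_contracts) simp
  ultimately show ?thesis by simp
qed

text \<open>A strict inequality at time \<open>t\<close> persists along rational times decreasing to
  \<open>t\<close>.\<close>

lemma pred_ex_dist_less: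
  "Measurable.pred F_infty (\<lambda>\<omega>. \<exists>t\<in>T. dist (\<phi> t \<omega> x) (\<phi> t \<omega> y) < \<epsilon>)"
proof -
  have eq: "(\<exists>t\<in>T. dist (\<phi> t \<omega> x) (\<phi> t \<omega> y) < \<epsilon>) \<longleftrightarrow>
      (\<exists>t\<in>rational_times. dist (\<phi> t \<omega> x) (\<phi> t \<omega> y) < \<epsilon>)" if \<omega>: "\<omega> \<in> space M" for \<omega>
  proof
    assume "\<exists>t\<in>T. dist (\<phi> t \<omega> x) (\<phi> t \<omega> y) < \<epsilon>"
    then obtain t where t: "t \<in> T" "dist (\<phi> t \<omega> x) (\<phi> t \<omega> y) < \<epsilon>" by blast
    obtain ts where ts: "range ts \<subseteq> rational_times"
        "\<And>x. (\<lambda>n. \<phi> (ts n) \<omega> x) \<longlonglongrightarrow> \<phi> t \<omega> x"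
      using traj_rational_approx[OF t(1) \<omega>] by metis
    from order_tendstoD(2)[OF tendsto_dist[OF ts(2)[of x] ts(2)[of y]] t(2)]
    obtain n where "dist (\<phi> (ts n) \<omega> x) (\<phi> (ts n) \<omega> y) < \<epsilon>"
      by (auto simp: eventually_sequentially)
    then show "\<exists>t\<in>rational_times. dist (\<phi> t \<omega> x) (\<phi> t \<omega> y) < \<epsilon>" using ts(1) by blast
  qed (use rational_timesD in blast)
  have "Measurable.pred F_infty (\<lambda>\<omega>. \<exists>t\<in>rational_times. dist (\<phi> t \<omega> x) (\<phi> t \<omega> y) < \<epsilon>)"
    using countable_rational_times
    by (intro measurable_pred_countable pred_traj_dist) (auto dest: rational_timesD)
  then show ?thesis by (rule measurable_cong[THEN iffD2, rotated]) (use eq in simp)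
qed

lemma synchronising_iff_AE:
  "synchronising T M \<phi> \<longleftrightarrow> (\<forall>x y. AE \<omega> in M. contracts T \<phi> \<omega> {x, y})"
  unfolding synchronising_def mutually_converge_def using prob_eq_1_iff_AE[OF pred_contracts] by simp

lemma almost_surely_stable_iff_AE:
  "almost_surely_stable T M \<phi> x \<longleftrightarrow> (AE \<omega> in M. asymptotically_stable T \<phi> \<omega> x)"
  unfolding almost_surely_stable_def
  using prob_eq_1_iff_AE[OF pred_ex_asymptotically_stable[of "{x}"]] by simp

subsection \<open>The two-point motion\<close>

text \<open>Both points feel the same noise; hence the diagonal is preserved, and one contraction
  event serves both coordinates.\<close>

definition pair_motion :: "real \<Rightarrow> 'w \<Rightarrow> 'x \<times> 'x \<Rightarrow> 'x \<times> 'x" where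
  "pair_motion t \<omega> p = (\<phi> t \<omega> (fst p), \<phi> t \<omega> (snd p))"

lemma compact_random_dynamical_system_pair_motion:
  "compact_random_dynamical_system T M F \<theta> pair_motion"
proof unfold_locales
  show "compact (UNIV :: ('x \<times> 'x) set)"
    using compact_Times[OF compact_space compact_space] by simp
  show "continuous_on UNIV (pair_motion t \<omega>)" if "t \<in> T" "\<omega> \<in> space M" for t \<omega>
    unfolding pair_motion_def
    by (intro continuous_on_Pair continuous_on_compose2[OF continuous[OF that]]
        continuous_on_fst continuous_on_snd continuous_on_id) auto
  show "(\<lambda>(\<omega>, p). pair_motion t \<omega> p) \<in> measurable (F t \<Otimes>\<^sub>M borel) borel" if t: "t \<in> T" for t
  proof -
    have "(\<lambda>q. \<phi> t (fst q) (f (snd q))) \<in> measurable (F t \<Otimes>\<^sub>M borel) borel"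
      if f: "continuous_on UNIV f" for f :: "'x \<times> 'x \<Rightarrow> 'x"
    proof -
      have "(\<lambda>q. (fst q, f (snd q))) \<in> measurable (F t \<Otimes>\<^sub>M borel) (F t \<Otimes>\<^sub>M borel)"
        by (intro measurable_Pair measurable_fst
            measurable_compose[OF measurable_snd borel_measurable_continuous_onI[OF f]])
      from measurable_compose[OF this adapted[OF t]] show ?thesis by simp
    qed
    then show ?thesis
      unfolding pair_motion_def split_beta'
      by (intro borel_measurable_Pair_compact[OF compact_space])
        (simp_all add: continuous_on_fst continuous_on_snd continuous_on_id)
  qed
  show "pair_motion 0 \<omega> = id" if "\<omega> \<in> space M" for \<omega>
    using zero[OF that] by (simp add: pair_motion_def fun_eq_iff)
  show "pair_motion (s + t) \<omega> = pair_motion t (\<theta> s \<omega>) \<circ> pair_motion s \<omega>"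
    if "s \<in> T" "t \<in> T" "\<omega> \<in> space M" for s t \<omega>
    using cocycle[OF that] by (simp add: pair_motion_def fun_eq_iff)
  show "(\<lambda>n. pair_motion (ts n) \<omega> (ps n)) \<longlonglongrightarrow> pair_motion t \<omega> p"
    if "t \<in> T" "\<omega> \<in> space M" "range ts \<subseteq> T" "decseq ts" "ts \<longlonglongrightarrow> t" "ps \<longlonglongrightarrow> p" for t \<omega> p ts ps
    unfolding pair_motion_def
    by (intro tendsto_Pair right_continuous that tendsto_fst tendsto_snd)
  obtain \<phi>m :: "real \<Rightarrow> 'w \<Rightarrow> 'x \<Rightarrow> 'x" where \<phi>m: "\<And>t \<omega> x ts xs. t \<in> T \<Longrightarrow> \<omega> \<in> space M \<Longrightarrow>
      range ts \<subseteq> T \<Longrightarrow> strict_mono ts \<Longrightarrow> ts \<longlonglongrightarrow> t \<Longrightarrow> xs \<longlonglongrightarrow> x \<Longrightarrow>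
      (\<lambda>n. \<phi> (ts n) \<omega> (xs n)) \<longlonglongrightarrow> \<phi>m t \<omega> x"
    using left_limits by blast
  show "\<exists>\<psi> :: real \<Rightarrow> 'w \<Rightarrow> 'x \<times> 'x \<Rightarrow> 'x \<times> 'x. \<forall>t\<in>T. \<forall>\<omega>\<in>space M. \<forall>p ts ps.
      range ts \<subseteq> T \<and> strict_mono ts \<and> ts \<longlonglongrightarrow> t \<and> ps \<longlonglongrightarrow> p
      \<longrightarrow> (\<lambda>n. pair_motion (ts n) \<omega> (ps n)) \<longlonglongrightarrow> \<psi> t \<omega> p"
    unfolding pair_motion_def
    by (rule exI[of _ "\<lambda>t \<omega> p. (\<phi>m t \<omega> (fst p), \<phi>m t \<omega> (snd p))"])
      (intro ballI allI impI, elim conjE, intro tendsto_Pair \<phi>m tendsto_fst tendsto_snd)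
qed

interpretation pair: compact_random_dynamical_system T M F \<theta> pair_motion
  by (rule compact_random_dynamical_system_pair_motion)

text \<open>Each projection intertwines the two-point motion with \<open>\<phi>\<close>, and images
  of compact sets are closed. The disjunction treats both coordinates at once.\<close>

lemma forward_invariant_image_pair:
  assumes f: "f = fst \<or> f = snd" and L: "closed L" "pair.inv_set L"
  shows "closed (f ` L)" "inv_set (f ` L)"
proof -
  have "continuous_on L f" using f continuous_on_fst[OF continuous_on_id]
      continuous_on_snd[OF continuous_on_id] by auto
  moreover have "compact L"
    using compact_Int_closed[OF pair.compact_space L(1)] by simp
  ultimately have "compact (f ` L)" by (rule compact_continuous_image)
  then show cl: "closed (f ` L)" by (rule compact_imp_closed)
  have f_motion: "f (pair_motion t \<omega> p) = \<phi> t \<omega> (f p)" for t \<omega> p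
    using f by (auto simp: pair_motion_def)
  show "inv_set (f ` L)"
    unfolding forward_invariant_pointwise_iff[OF cl]
  proof safe
    fix p t assume "p \<in> L" "t \<in> rational_times"
    then have "AE \<omega> in M. pair_motion t \<omega> p \<in> L"
      using L pair.forward_invariant_pointwise_iff by blast
    then show "AE \<omega> in M. \<phi> t \<omega> (f p) \<in> f ` L"
      by eventually_elim (use f_motion in \<open>metis imageI\<close>)
  qed
qed

lemma forward_invariant_vimage_pair:
  assumes f: "f = fst \<or> f = snd" and K: "closed K" "inv_set K"
  shows "closed (f -` K)" "pair.inv_set (f -` K)"
proof -
  show cl: "closed (f -` K)"
    using f K(1) closed_vimage_fst closed_vimage_snd by auto
  show "pair.inv_set (f -` K)"
    unfolding pair.forward_invariant_pointwise_iff[OF cl]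
    using K f forward_invariant_pointwise_iff by (auto simp: pair_motion_def)
qed

text \<open>Each projection of \<open>L\<close> is closed and invariant, so it contains a minimal
  set, which must be \<open>K\<close>. Hence \<open>L\<close> meets the invariant preimage of
  \<open>K\<close>, and minimality of \<open>L\<close> puts it inside.\<close>

lemma minimal_pair_subset:
  assumes uniq: "\<And>L. minimal_set T M \<phi> L \<Longrightarrow> L = K" and K: "minimal_set T M \<phi> K"
    and L: "minimal_set T M pair_motion L"
  shows "L \<subseteq> K \<times> K"
proof -
  have "L \<subseteq> f -` K" if f: "f = fst \<or> f = snd" for f :: "'x \<times> 'x \<Rightarrow> 'x"
  proof -
    obtain K' where K': "K' \<subseteq> f ` L" "minimal_set T M \<phi> K'"
      using minimal_set_exists forward_invariant_image_pair[OF f] minimal_setD(1-3)[OF L]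
      by (metis image_is_empty)
    then have "K \<subseteq> f ` L" using uniq by blast
    then have "L \<inter> f -` K \<noteq> {}" using minimal_setD(1)[OF K] by blast
    moreover have "closed (L \<inter> f -` K)" "pair.inv_set (L \<inter> f -` K)"
      using forward_invariant_vimage_pair[OF f minimal_setD(2,3)[OF K]] minimal_setD(2,3)[OF L]
      by (auto intro: pair.forward_invariant_Int)
    ultimately have "L \<inter> f -` K = L" by (intro minimal_setD(4)[OF L]) simp_all
    then show ?thesis by blast
  qed
  from this[of fst] this[of snd] show ?thesis by auto
qed

text \<open>A pair of least distance in the compact set \<open>L\<close> exists. Were that distance
  positive, contractibility with this distance as \<open>\<epsilon>\<close> would produce a strictly
  closer pair, still in \<open>L\<close> by invariance.\<close>

lemma minimal_pair_meets_diagonal: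
  assumes K: "two_point_contractible T M \<phi> K" and LK: "L \<subseteq> K \<times> K"
    and L: "L \<noteq> {}" "closed L" "pair.inv_set L"
  shows "\<exists>z. (z, z) \<in> L"
proof -
  have "compact L" using compact_Int_closed[OF pair.compact_space L(2)] by simp
  moreover have "continuous_on L (\<lambda>p. dist (fst p) (snd p))" by (intro continuous_intros)
  ultimately obtain p where p: "p \<in> L" "\<And>q. q \<in> L \<Longrightarrow> dist (fst p) (snd p) \<le> dist (fst q) (snd q)"
    using continuous_attains_inf[OF _ L(1)] by blast
  have "dist (fst p) (snd p) = 0"
  proof (rule ccontr)
    assume "dist (fst p) (snd p) \<noteq> 0"
    then have "dist (fst p) (snd p) > 0" by simp
    moreover have "fst p \<in> K" "snd p \<in> K" using p(1) LK by auto
    ultimately have "\<P>(\<omega> in M. \<exists>t\<in>T. dist (\<phi> t \<omega> (fst p)) (\<phi> t \<omega> (snd p)) < dist (fst p) (snd p)) > 0"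
      using K unfolding two_point_contractible_def by blast
    moreover have "AE \<omega> in M. \<forall>t\<in>T. pair_motion t \<omega> ` L \<subseteq> L"
      using pair.forward_invariant_AE_iff L by blast
    ultimately obtain \<omega> where
        "\<exists>t\<in>T. dist (\<phi> t \<omega> (fst p)) (\<phi> t \<omega> (snd p)) < dist (fst p) (snd p)"
        "\<forall>t\<in>T. pair_motion t \<omega> ` L \<subseteq> L"
      by (rule exists_if_prob_pos)
    then obtain t where t: "dist (\<phi> t \<omega> (fst p)) (\<phi> t \<omega> (snd p)) < dist (fst p) (snd p)"
        "pair_motion t \<omega> p \<in> L" using p(1) by blast
    then show False using p(2)[OF t(2)] by (simp add: pair_motion_def)
  qed
  then show ?thesis using p(1) by (metis dist_eq_0_iff prod.collapse)
qed

section \<open>From the three conditions to stable synchronisation\<close>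

lemma stably_synchronising_if:
  assumes uniq: "\<And>L. minimal_set T M \<phi> L \<Longrightarrow> L = K" and K: "minimal_set T M \<phi> K"
    and tpc: "two_point_contractible T M \<phi> K" and stable: "admits_stable_trajectories T M \<phi> K"
  shows "stably_synchronising T M \<phi>"
proof -
  obtain B :: "nat \<Rightarrow> 'x set" where B: "\<And>n. open (B n)"
      "\<And>S x. open S \<Longrightarrow> x \<in> S \<Longrightarrow> \<exists>n. x \<in> B n \<and> B n \<subseteq> S"
    using compact_countable_base[OF compact_space] by blast
  \<comment> \<open>Stable trajectories only give a random neighbourhood; as there are countably
    many base sets, a deterministic one contracts with positive probability.\<close>
  have "\<exists>n. K \<inter> B n \<noteq> {} \<and> \<P>(\<omega> in M. contracts T \<phi> \<omega> (B n)) > 0"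
  proof (rule ccontr)
    assume none: "\<not> ?thesis"
    have "AE \<omega> in M. \<not> contracts T \<phi> \<omega> (B n)" if "K \<inter> B n \<noteq> {}" for n
      using none that prob_Collect_eq_0[OF pred_F_inftyD[OF pred_contracts]]
      by (metis zero_less_measure_iff)
    then have "AE \<omega> in M. \<forall>n\<in>{n. K \<inter> B n \<noteq> {}}. \<not> contracts T \<phi> \<omega> (B n)"
      by (intro AE_ball_countable') simp_all
    with stable obtain \<omega> where "\<exists>x\<in>K. asymptotically_stable T \<phi> \<omega> x"
        "\<forall>n\<in>{n. K \<inter> B n \<noteq> {}}. \<not> contracts T \<phi> \<omega> (B n)"
      unfolding admits_stable_trajectories_def by (rule exists_if_prob_pos)
    then show False using asymptotically_stable_base_iff[of B, OF B] by blast
  qed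
  then obtain n where n: "K \<inter> B n \<noteq> {}" "\<P>(\<omega> in M. contracts T \<phi> \<omega> (B n)) > 0" by blast
  define U where "U = B n"
  define E where "E = {\<omega> \<in> space M. contracts T \<phi> \<omega> U}"
  have U: "open U" using B(1) by (simp add: U_def)
  have E: "E \<in> sets F_infty" "prob E > 0"
    using predE[OF pred_contracts] n(2) by (simp_all add: E_def U_def)
  have reach: "\<exists>t\<in>rational_times. \<P>(\<omega> in M. \<phi> t \<omega> x \<in> U) > 0" for x
    using U by (rule reachable) (use uniq n(1) in \<open>auto simp: U_def\<close>)
  have stable_if_hit: "asymptotically_stable T \<phi> \<omega> x"
    if \<omega>: "\<omega> \<in> space M" and t: "t \<in> rational_times" "\<phi> t \<omega> x \<in> U" "\<theta> t \<omega> \<in> E" for \<omega> x t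
  proof -
    note tT = rational_timesD[OF t(1)]
    \<comment> \<open>The neighbourhood of \<open>x\<close> that witnesses stability is the preimage
      of \<open>U\<close>, open by continuity of \<open>\<phi> t \<omega>\<close>.\<close>
    have "contracts T \<phi> \<omega> (\<phi> t \<omega> -` U)"
      using t(3) by (intro contracts_pullback[OF \<omega> tT, of U]) (auto simp: E_def)
    then show ?thesis
      unfolding asymptotically_stable_def
      using t(2) interior_open[OF traj_vimage_open[OF tT \<omega> U]] by blast
  qed
  have "almost_surely_stable T M \<phi> x" for x
    unfolding almost_surely_stable_iff_AE
    using reach_then_event_AE[OF U reach E, of x] AE_space
    by eventually_elim (use stable_if_hit in blast)
  moreover have "synchronising T M \<phi>"
    unfolding synchronising_iff_AE
  proof (intro allI)
    fix x y
    have UU: "open (U \<times> U)" using U by (rule open_Times[OF _ U])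
    have "\<exists>t\<in>rational_times. \<P>(\<omega> in M. pair_motion t \<omega> p \<in> U \<times> U) > 0" for p
      using UU
    proof (rule pair.reachable)
      fix L assume L: "minimal_set T M pair_motion L"
      note LD = minimal_setD[OF L]
      obtain z where z: "(z, z) \<in> L"
        using minimal_pair_meets_diagonal[OF tpc minimal_pair_subset[OF uniq K L] LD(1-3)] by blast
      \<comment> \<open>From \<open>(z, z)\<close> both coordinates stay equal, so reachability of
        \<open>U\<close> from \<open>z\<close> already brings the pair into
        \<open>U \<times> U\<close>.\<close>
      obtain t where t: "t \<in> rational_times" "\<P>(\<omega> in M. \<phi> t \<omega> z \<in> U) > 0"
        using reach by blast
      have "AE \<omega> in M. pair_motion t \<omega> (z, z) \<in> L"
        using pair.forward_invariant_pointwise_iff LD(2,3) z t(1) by blast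
      with t(2) obtain \<omega> where "\<phi> t \<omega> z \<in> U" "pair_motion t \<omega> (z, z) \<in> L"
        by (rule exists_if_prob_pos)
      then show "L \<inter> U \<times> U \<noteq> {}" by (auto simp: pair_motion_def)
    qed
    \<comment> \<open>The event \<open>E\<close> concerns only the noise, so it is reused for pairs:
      once both points are in \<open>U\<close>, contraction of \<open>U\<close> brings them
      together.\<close>
    from pair.reach_then_event_AE[OF UU this E, of "(x, y)"] AE_space
    show "AE \<omega> in M. contracts T \<phi> \<omega> {x, y}"
    proof eventually_elim
      case (elim \<omega>)
      from elim(1) obtain t where t: "t \<in> rational_times"
          "pair_motion t \<omega> (x, y) \<in> U \<times> U" "\<theta> t \<omega> \<in> E"
        by (elim bexE conjE)
      show ?case
        using elim(2) rational_timesD[OF t(1)] t(2,3)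
        by (intro contracts_pullback[of \<omega> t U]) (simp_all add: E_def pair_motion_def)
    qed
  qed
  ultimately show ?thesis unfolding stably_synchronising_def by blast
qed

section \<open>From stable synchronisation to the three conditions\<close>

text \<open>If the sets meet, their intersection is closed, invariant and non-empty, hence equal to
  both. If not, compactness puts them at a distance \<open>d > 0\<close>, which invariance
  preserves, against the convergence of a point of \<open>K\<close> to one of
  \<open>L\<close>.\<close>

lemma minimal_set_unique_if_synchronising:
  assumes sync: "synchronising T M \<phi>" and K: "minimal_set T M \<phi> K" and L: "minimal_set T M \<phi> L"
  shows "K = L"
proof (cases "K \<inter> L = {}")
  case True
  note KD = minimal_setD[OF K] and LD = minimal_setD[OF L]
  have "compact (K \<times> L)"
    using compact_Int_closed[OF compact_space KD(2)] compact_Int_closed[OF compact_space LD(2)]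
    by (simp add: compact_Times)
  moreover have "K \<times> L \<noteq> {}" using KD(1) LD(1) by blast
  moreover have "continuous_on (K \<times> L) (\<lambda>p. dist (fst p) (snd p))" by (intro continuous_intros)
  ultimately have "\<exists>p\<in>K \<times> L. \<forall>q\<in>K \<times> L. dist (fst p) (snd p) \<le> dist (fst q) (snd q)"
    by (rule continuous_attains_inf)
  then obtain p where p: "p \<in> K \<times> L"
      "\<And>q. q \<in> K \<times> L \<Longrightarrow> dist (fst p) (snd p) \<le> dist (fst q) (snd q)"
    by blast
  define d where "d = dist (fst p) (snd p)"
  have d: "d > 0" "\<And>a b. a \<in> K \<Longrightarrow> b \<in> L \<Longrightarrow> d \<le> dist a b"
    using p True by (auto simp: d_def)
  obtain x y where xy: "x \<in> K" "y \<in> L" using KD(1) LD(1) by blast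
  have "AE \<omega> in M. contracts T \<phi> \<omega> {x, y}" using sync synchronising_iff_AE by blast
  moreover have "AE \<omega> in M. \<forall>t\<in>T. \<phi> t \<omega> ` K \<subseteq> K" "AE \<omega> in M. \<forall>t\<in>T. \<phi> t \<omega> ` L \<subseteq> L"
    using KD LD forward_invariant_AE_iff by blast+
  ultimately have "AE \<omega> in M. False"
  proof eventually_elim
    case (elim \<omega>)
    obtain t where "t \<in> T" "dist (\<phi> t \<omega> x) (\<phi> t \<omega> y) < d"
      using contracts_dist_less[OF elim(1) d(1)] by (metis insertCI)
    moreover have "\<phi> t \<omega> x \<in> K" "\<phi> t \<omega> y \<in> L" using elim(2,3) xy \<open>t \<in> T\<close> by blast+
    ultimately show False using d(2)[of "\<phi> t \<omega> x" "\<phi> t \<omega> y"] by linarith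
  qed
  then show ?thesis by simp
next
  case False
  note KD = minimal_setD[OF K] and LD = minimal_setD[OF L]
  have "closed (K \<inter> L)" "inv_set (K \<inter> L)"
    using KD LD by (auto intro: forward_invariant_Int)
  then show ?thesis
    using KD(4)[of "K \<inter> L"] LD(4)[of "K \<inter> L"] False by blast
qed

lemma two_point_contractible_if_synchronising:
  assumes "synchronising T M \<phi>"
  shows "two_point_contractible T M \<phi> K"
  unfolding two_point_contractible_def
proof (intro ballI allI impI)
  fix x y and \<epsilon> :: real assume \<epsilon>: "\<epsilon> > 0"
  have "AE \<omega> in M. contracts T \<phi> \<omega> {x, y}" using assms synchronising_iff_AE by blast
  then have "AE \<omega> in M. \<exists>t\<in>T. dist (\<phi> t \<omega> x) (\<phi> t \<omega> y) < \<epsilon>"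
    by eventually_elim (use contracts_dist_less[OF _ \<epsilon>] in blast)
  then have "\<P>(\<omega> in M. \<exists>t\<in>T. dist (\<phi> t \<omega> x) (\<phi> t \<omega> y) < \<epsilon>) = 1"
    by (rule prob_eq_1_iff_AE[OF pred_ex_dist_less, THEN iffD2])
  then show "\<P>(\<omega> in M. \<exists>t\<in>T. dist (\<phi> t \<omega> x) (\<phi> t \<omega> y) < \<epsilon>) > 0"
    by linarith
qed

lemma admits_stable_trajectories_if_stable:
  assumes "x \<in> K" "almost_surely_stable T M \<phi> x"
  shows "admits_stable_trajectories T M \<phi> K"
proof -
  have "AE \<omega> in M. asymptotically_stable T \<phi> \<omega> x"
    using assms(2) by (simp add: almost_surely_stable_iff_AE)
  then have "AE \<omega> in M. \<exists>x\<in>K. asymptotically_stable T \<phi> \<omega> x"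
    by eventually_elim (use assms(1) in blast)
  then have "\<P>(\<omega> in M. \<exists>x\<in>K. asymptotically_stable T \<phi> \<omega> x) = 1"
    by (rule prob_eq_1_iff_AE[OF pred_ex_asymptotically_stable, THEN iffD2])
  then show ?thesis unfolding admits_stable_trajectories_def by linarith
qed

text \<open>Conditions (ii) and (iii) concern the \<open>K\<close> of (i). Quantifying over all
  minimal sets expresses this without naming it, since under (i) there is exactly one.\<close>

lemma stably_synchronising_iff:
  "stably_synchronising T M \<phi> \<longleftrightarrow>
    (\<exists>!K. minimal_set T M \<phi> K) \<and>
    (\<forall>K. minimal_set T M \<phi> K \<longrightarrow> two_point_contractible T M \<phi> K) \<and>
    (\<forall>K. minimal_set T M \<phi> K \<longrightarrow> admits_stable_trajectories T M \<phi> K)"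
proof
  assume S: "stably_synchronising T M \<phi>"
  then have sync: "synchronising T M \<phi>" and stable: "\<And>x. almost_surely_stable T M \<phi> x"
    by (simp_all add: stably_synchronising_def)
  \<comment> \<open>Existence of a minimal set starts from the whole space, which is non-empty
    because every type is inhabited.\<close>
  have "inv_set UNIV" by (simp add: forward_invariant_AE_iff)
  then obtain K where "minimal_set T M \<phi> K"
    using minimal_set_exists[of UNIV] by blast
  then have "\<exists>!K. minimal_set T M \<phi> K"
    using minimal_set_unique_if_synchronising[OF sync] by blast
  moreover have "admits_stable_trajectories T M \<phi> K" if "minimal_set T M \<phi> K" for K
    using minimal_setD(1)[OF that] stable admits_stable_trajectories_if_stable by blast
  ultimately show "(\<exists>!K. minimal_set T M \<phi> K) \<and>
      (\<forall>K. minimal_set T M \<phi> K \<longrightarrow> two_point_contractible T M \<phi> K) \<and>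
      (\<forall>K. minimal_set T M \<phi> K \<longrightarrow> admits_stable_trajectories T M \<phi> K)"
    using two_point_contractible_if_synchronising[OF sync] by blast
next
  assume R: "(\<exists>!K. minimal_set T M \<phi> K) \<and>
    (\<forall>K. minimal_set T M \<phi> K \<longrightarrow> two_point_contractible T M \<phi> K) \<and>
    (\<forall>K. minimal_set T M \<phi> K \<longrightarrow> admits_stable_trajectories T M \<phi> K)"
  then obtain K where K: "minimal_set T M \<phi> K" by blast
  show "stably_synchronising T M \<phi>"
  proof (rule stably_synchronising_if[OF _ K])
    show "L = K" if "minimal_set T M \<phi> L" for L using R K that by blast
  qed (use R K in blast)+
qed

end

theorem theorem3p2p1:
  fixes T :: "real set" and M :: "'w measure" and F :: "real \<Rightarrow> 'w measure"
    and \<theta> :: "real \<Rightarrow> 'w \<Rightarrow> 'w" and \<phi> :: "real \<Rightarrow> 'w \<Rightarrow> 'x::metric_space \<Rightarrow> 'x"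
  assumes "compact (UNIV :: 'x set)"
    and "random_dynamical_system T M F \<theta> \<phi>"
  shows "stably_synchronising T M \<phi> \<longleftrightarrow>
    (\<exists>!K. minimal_set T M \<phi> K) \<and>
    (\<forall>K. minimal_set T M \<phi> K \<longrightarrow> two_point_contractible T M \<phi> K) \<and>
    (\<forall>K. minimal_set T M \<phi> K \<longrightarrow> admits_stable_trajectories T M \<phi> K)"
proof -
  interpret compact_random_dynamical_system T M F \<theta> \<phi>
    using assms by (intro compact_random_dynamical_system.intro
      compact_random_dynamical_system_axioms.intro)
  show ?thesis by (rule stably_synchronising_iff)
qed

end
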